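(* Let $n\ge1$. A set $X\subseteq\mathbb R^n$ is meager-additive if and only if it has sharp measure zero (with respect to the Euclidean metric).
   Context: $X\subseteq\mathbb R^n$ is meager-additive if $X+M=\{x+m:x\in X,m\in M\}$ is meager in $\mathbb R^n$ for every meager $M\subseteq\mathbb R^n$. For $s>0$, $\mathcal H^s(E)=\sup_{\delta>0}\inf\{\sum_k(\operatorname{diam}E_k)^s\}$, infimum over countable covers of $E$ by sets of diameter $\le\delta$, and $\dim_H E=\inf\{s>0:\mathcal H^s(E)=0\}$. A metric space $X$ has sharp measure zero if for every uniformly continuous map $f:X\to Y$ into a complete metric space $Y$ there is a $\sigma$-compact $K\subseteq Y$ with $f(X)\subseteq K$ and $\dim_H K=0$. *)

theory Defs
  imports "HOL-Analysis.Analysis"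
begin

definition nowhere_dense :: "'a::topological_space set \<Rightarrow> bool" where
  "nowhere_dense A \<longleftrightarrow> interior (closure A) = {}"

definition meager :: "'a::topological_space set \<Rightarrow> bool" where
  "meager S \<longleftrightarrow> (\<exists>\<F>. countable \<F> \<and> (\<forall>A\<in>\<F>. nowhere_dense A) \<and> S = \<Union>\<F>)"

definition meager_additive :: "'a::{topological_space, plus} set \<Rightarrow> bool" where
  "meager_additive X \<longleftrightarrow> (\<forall>M. meager M \<longrightarrow> meager {x + m |x m. x \<in> X \<and> m \<in> M})"

definition mdiam :: "'b metric \<Rightarrow> 'b set \<Rightarrow> ennreal" where
  "mdiam Y A = (SUP x\<in>A. SUP y\<in>A. ennreal (mdist Y x y))"

text \<open>Countable covers are given as sequences; a finite cover is padded with empty sets, which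
  contribute \<open>0\<close> since \<open>s > 0\<close> in all uses. Covering sets have finite diameter, so
  \<open>enn2real\<close> loses nothing. If there is no cover, the infimum is \<open>\<infinity>\<close>.\<close>

definition hausdorff_measure :: "'b metric \<Rightarrow> real \<Rightarrow> 'b set \<Rightarrow> ennreal" where
  "hausdorff_measure Y s E =
     (SUP \<delta>\<in>{0::real<..}.
        INF C\<in>{C :: nat \<Rightarrow> 'b set. E \<subseteq> (\<Union>k. C k) \<and>
                 (\<forall>k. C k \<subseteq> mspace Y \<and> mdiam Y (C k) \<le> ennreal \<delta>)}.
          (\<Sum>k. ennreal (enn2real (mdiam Y (C k)) powr s)))"

definition hausdorff_dim :: "'b metric \<Rightarrow> 'b set \<Rightarrow> ennreal" where
  "hausdorff_dim Y E = Inf {ennreal s |s. s > 0 \<and> hausdorff_measure Y s E = 0}"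

definition sigma_compact_in :: "'b topology \<Rightarrow> 'b set \<Rightarrow> bool" where
  "sigma_compact_in T K \<longleftrightarrow> (\<exists>\<C>. countable \<C> \<and> (\<forall>C\<in>\<C>. compactin T C) \<and> K = \<Union>\<C>)"

text \<open>HOL cannot quantify over types inside a formula, so the type that supplies the points of the
  target spaces \<open>Y\<close> is a parameter: \<open>Y\<close> ranges over all complete metric spaces whose carrier is
  any subset of \<open>'b\<close>. For small types \<open>'b\<close> this is weaker than the intended notion. When
  \<open>M\<close> is separable, it agrees with the intended notion as soon as \<open>'b\<close> has at least the cardinality
  of the continuum: one may replace \<open>Y\<close> by the closure of the image of \<open>M\<close>, a complete separable
  space, which is isometric to a space carried by a subset of \<open>'b\<close>.\<close>

definition sharp_measure_zero :: "'b itself \<Rightarrow> 'a metric \<Rightarrow> bool" where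
  "sharp_measure_zero _ M \<longleftrightarrow>
     (\<forall>(Y :: 'b metric) f. mcomplete_of Y \<and> uniformly_continuous_map M Y f \<longrightarrow>
        (\<exists>K. K \<subseteq> mspace Y \<and> sigma_compact_in (mtopology_of Y) K \<and>
             f ` mspace M \<subseteq> K \<and> hausdorff_dim Y K = 0))"

end

theory Submission
  imports Defs
begin

text \<open>Both notions are equivalent to a covering property: for every sequence of positive reals
  \<open>\<epsilon>\<close>, the set \<open>X\<close> is a countable union of pieces, each of which admits, for every \<open>p\<close>, a finite
  cover whose \<open>j\<close>-th member has diameter at most \<open>\<epsilon> (p + j)\<close>.

  Uniformly continuous maps transport such covers, and with diameters \<open>2\<^sup>-\<^sup>j\<close> the closure of the image
  of a piece is compact with all Hausdorff measures zero; conversely one applies sharp measure zero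
  to \<open>\<real>\<^sup>n\<close> with the metric \<open>\<phi> (dist x y)\<close>, where \<open>\<phi>\<close> tends to zero so slowly that a finite cover with
  small \<open>\<phi>\<close>-diameter sum, sorted by size, has the required diameters.

  The covers of a piece let one find, in any ball, a smaller ball missing the sum of the piece and a
  compact nowhere dense set, by avoiding the translates coming from the members of the cover one
  after the other. Conversely, take a rapidly refining sequence of lattices \<open>G k\<close> and the meager set
  \<open>M\<close> of points that keep a distance \<open>R (k+1)\<close> from \<open>G k\<close> for all large \<open>k\<close>. If \<open>X + M\<close> is meager,
  there are finite blocks of scales and shifts \<open>\<tau> n\<close> such that every \<open>x \<in> X\<close> is, in almost all
  blocks, close to \<open>\<tau> n + G k\<close> at some scale \<open>k\<close> of the block. The bounded parts of these shifted
  lattices are the centres of the required covers.\<close>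

section \<open>The covering property that links both notions\<close>

text \<open>The shift \<open>p\<close> lets a cover start arbitrarily far out in
  \<open>\<epsilon>\<close>, hence at any prescribed scale. Finiteness of the covers yields total
  boundedness of uniformly continuous images and bounds the number of steps in the ball
  construction.\<close>

definition finely_covered :: "(nat \<Rightarrow> real) \<Rightarrow> 'a::metric_space set \<Rightarrow> bool" where
  "finely_covered \<epsilon> A \<longleftrightarrow>
     (\<forall>p. \<exists>N U. A \<subseteq> (\<Union>j<N. U j) \<and> (\<forall>j<N. \<forall>x\<in>U j. \<forall>y\<in>U j. dist x y \<le> \<epsilon> (p + j)))"

definition sigma_finely_coverable :: "'a::metric_space set \<Rightarrow> bool" where
  "sigma_finely_coverable X \<longleftrightarrow>
     (\<forall>\<epsilon>. (\<forall>i. \<epsilon> i > 0) \<longrightarrow>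
        (\<exists>A :: nat \<Rightarrow> 'a set. X \<subseteq> (\<Union>m. A m) \<and> (\<forall>m. finely_covered \<epsilon> (A m))))"

section \<open>Meager sets\<close>

text \<open>\<open>meager\<close> asks for an exact union, so each nowhere dense piece is cut down
  to \<open>T\<close>.\<close>

lemma meager_subset:
  assumes "meager S" "T \<subseteq> S"
  shows "meager T"
proof -
  obtain \<F> where \<F>: "countable \<F>" "\<forall>A\<in>\<F>. nowhere_dense A" "S = \<Union>\<F>"
    using assms(1) unfolding meager_def by blast
  have "nowhere_dense (A \<inter> T)" if "A \<in> \<F>" for A
    using \<F>(2) that interior_mono[OF closure_mono[of "A \<inter> T" A]]
    unfolding nowhere_dense_def by blast
  moreover have "T = \<Union>((\<lambda>A. A \<inter> T) ` \<F>)"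
    using assms(2) \<F>(3) by blast
  ultimately show ?thesis
    unfolding meager_def using \<F>(1) by (metis (no_types, lifting) countable_image imageE)
qed

lemma nowhere_dense_Un:
  assumes "nowhere_dense A" "nowhere_dense B"
  shows "nowhere_dense (A \<union> B)"
  using assms interior_closed_Un_empty_interior[of "closure A" "closure B"]
  unfolding nowhere_dense_def by simp

lemma nowhere_dense_closure: "nowhere_dense A \<Longrightarrow> nowhere_dense (closure A)"
  unfolding nowhere_dense_def by simp

lemma nowhere_dense_subset: "nowhere_dense A \<Longrightarrow> B \<subseteq> A \<Longrightarrow> nowhere_dense B"
  unfolding nowhere_dense_def using interior_mono[OF closure_mono] by blast

lemma nowhere_dense_empty [simp]: "nowhere_dense {}"
  unfolding nowhere_dense_def by simp

lemma nowhere_dense_UN: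
  assumes "finite I" "\<And>i. i \<in> I \<Longrightarrow> nowhere_dense (F i)"
  shows "nowhere_dense (\<Union>i\<in>I. F i)"
  using assms by (induction I) (auto intro: nowhere_dense_Un)

lemma meager_cover_closed_incseq:
  assumes "meager M"
  obtains F :: "nat \<Rightarrow> 'a::topological_space set"
  where "\<And>i. closed (F i)" "\<And>i. nowhere_dense (F i)" "incseq F" "M \<subseteq> (\<Union>i. F i)"
proof -
  obtain \<F> where \<F>: "countable \<F>" "\<forall>A\<in>\<F>. nowhere_dense A" "M = \<Union>\<F>"
    using assms unfolding meager_def by blast
  \<comment> \<open>The family may be empty; adding \<open>{}\<close> makes it the range of a
    sequence.\<close>
  define E where "E = from_nat_into (insert {} \<F>)"
  have E: "range E = insert {} \<F>"
    unfolding E_def using \<F>(1) by (intro range_from_nat_into) auto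
  then have ndE: "nowhere_dense (E i)" for i
    using \<F>(2) by (metis insert_iff nowhere_dense_empty rangeI)
  define F where "F i = (\<Union>j\<le>i. closure (E j))" for i
  show thesis
  proof
    show "closed (F i)" for i unfolding F_def by auto
    show "nowhere_dense (F i)" for i
      unfolding F_def by (intro nowhere_dense_UN nowhere_dense_closure ndE) auto
    show "incseq F" unfolding F_def incseq_def by fastforce
    show "M \<subseteq> (\<Union>i. F i)"
    proof
      fix x assume "x \<in> M"
      then obtain j where "x \<in> E j" using \<F>(3) E by (metis UnionE insertI2 imageE)
      then have "x \<in> F j" unfolding F_def using closure_subset by auto
      then show "x \<in> (\<Union>i. F i)" by blast
    qed
  qed
qed

section \<open>From fine covers to meager-additivity\<close>

text \<open>Compactness makes the hole size independent of the centre: finitely many balls of radius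
  \<open>\<delta>/4\<close>, each containing a hole, cover \<open>F\<close>. A centre close to
  \<open>F\<close> uses the hole of a nearby ball, a centre far from \<open>F\<close> is its own
  hole.\<close>

lemma nowhere_dense_uniform_holes:
  fixes F :: "'a::euclidean_space set"
  assumes "compact F" "nowhere_dense F" "\<delta> > 0"
  obtains \<epsilon> where "\<epsilon> > 0" "\<epsilon> \<le> \<delta> / 2"
    "\<And>c. \<exists>c'. cball c' \<epsilon> \<subseteq> cball c \<delta> \<and> (\<forall>z\<in>cball c' \<epsilon>. \<forall>f\<in>F. dist z f > \<epsilon>)"
proof -
  have hole: "\<exists>c' r. r > 0 \<and> ball c' r \<subseteq> ball p (\<delta>/4) - F" for p
  proof -
    have "open (ball p (\<delta>/4) - F)" using assms by (simp add: compact_imp_closed open_Diff)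
    moreover have "\<not> ball p (\<delta>/4) \<subseteq> F"
    proof
      assume "ball p (\<delta>/4) \<subseteq> F"
      then have "ball p (\<delta>/4) \<subseteq> interior (closure F)"
        by (metis closure_subset interior_maximal open_ball subset_trans)
      then show False
        using assms unfolding nowhere_dense_def by simp
    qed
    ultimately show ?thesis by (meson Diff_iff openE subsetI)
  qed
  then obtain h r where hr: "\<And>p. r p > 0" "\<And>p. ball (h p) (r p) \<subseteq> ball p (\<delta>/4) - F"
    by metis
  obtain P where P: "finite P" "F \<subseteq> (\<Union>p\<in>P. ball p (\<delta>/4))"
  proof -
    have "F \<subseteq> (\<Union>p\<in>F. ball p (\<delta>/4))" using assms(3) by auto
    then show thesis using compactE_image[OF assms(1), of F "\<lambda>p. ball p (\<delta>/4)"] that by blast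
  qed
  \<comment> \<open>\<open>h p\<close> keeps distance \<open>r p\<close> from \<open>F\<close>; the
    quarter leaves more than \<open>\<epsilon>\<close> after moving by \<open>\<epsilon>\<close>.
    The bound \<open>\<delta>/8\<close> keeps the hole inside \<open>cball c \<delta>\<close> and
    handles centres farther than \<open>\<delta>/4\<close> from \<open>F\<close>.\<close>
  define \<epsilon> where "\<epsilon> = Min (insert (\<delta>/8) ((\<lambda>p. r p / 4) ` P))"
  have \<epsilon>0: "\<epsilon> > 0" unfolding \<epsilon>_def using P(1) hr(1) assms(3) by auto
  have \<epsilon>1: "\<epsilon> \<le> \<delta>/8" unfolding \<epsilon>_def using P(1) by (intro Min_le) auto
  have \<epsilon>2: "\<epsilon> \<le> r p / 4" if "p \<in> P" for p unfolding \<epsilon>_def using P(1) that by (intro Min_le) auto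
  show thesis
  proof
    show "\<epsilon> > 0" by fact
    show "\<epsilon> \<le> \<delta>/2" using \<epsilon>1 assms(3) by linarith
    fix c
    show "\<exists>c'. cball c' \<epsilon> \<subseteq> cball c \<delta> \<and> (\<forall>z\<in>cball c' \<epsilon>. \<forall>f\<in>F. dist z f > \<epsilon>)"
    proof (cases "\<exists>f\<in>F. dist c f \<le> \<delta>/4")
      case True
      then obtain f p where f: "f \<in> F" "dist c f \<le> \<delta>/4" "p \<in> P" "dist p f < \<delta>/4"
        using P(2) by fastforce
      have cp: "dist c p < \<delta>/2"
        using f dist_triangle[of c p f] by (simp add: dist_commute)
      have hp: "h p \<in> ball p (\<delta>/4)" using hr[of p] by (meson DiffD1 centre_in_ball subsetD)
      show ?thesis
      proof (intro exI conjI ballI subsetI)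
        fix z assume z: "z \<in> cball (h p) \<epsilon>"
        have "dist c z \<le> dist c p + dist p (h p) + dist (h p) z"
          by (meson add_right_mono dist_triangle order_trans)
        then show "z \<in> cball c \<delta>" using cp hp z \<epsilon>1 assms(3) by auto
        fix g assume "g \<in> F"
        then have "dist (h p) g \<ge> r p" using hr(2)[of p] by force
        then show "dist z g > \<epsilon>"
          using z \<epsilon>2[OF f(3)] \<epsilon>0 dist_triangle[of "h p" g z] by simp
      qed
    next
      case False
      show ?thesis
      proof (intro exI conjI ballI subsetI)
        fix z assume z: "z \<in> cball c \<epsilon>"
        then show "z \<in> cball c \<delta>" using \<epsilon>1 assms(3) by auto
        fix g assume "g \<in> F"
        then have "dist c g > \<delta>/4" using False by force
        then show "dist z g > \<epsilon>" using z \<epsilon>1 dist_triangle[of c g z] by simp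
      qed
    qed
  qed
qed

text \<open>Inside a given ball the sets \<open>U 0, U 1, ...\<close> covering a piece are dealt
  with in turn. As \<open>U n\<close> is no larger than the hole radius at step \<open>n\<close>, a
  hole for one translate \<open>x + F (p + n)\<close> with \<open>x \<in> U n\<close> misses
  \<open>u + F i\<close> for all \<open>u \<in> U n\<close>. After finitely many steps a ball misses
  the whole sum.\<close>

lemma sigma_finely_coverable_imp_meager_additive:
  fixes X :: "'a::euclidean_space set"
  assumes X: "sigma_finely_coverable X"
  shows "meager_additive X"
  unfolding meager_additive_def
proof (intro allI impI)
  fix M :: "'a set" assume "meager M"
  then obtain F0 :: "nat \<Rightarrow> 'a set" where F0: "\<And>i. closed (F0 i)" "\<And>i. nowhere_dense (F0 i)"
    "incseq F0" "M \<subseteq> (\<Union>i. F0 i)"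
    using meager_cover_closed_incseq[of M] by blast
  \<comment> \<open>Cutting with growing balls makes the sets compact, while their increasing union
    still covers \<open>M\<close>.\<close>
  define F where "F i = F0 i \<inter> cball 0 (real i)" for i
  have cF: "compact (F i)" for i unfolding F_def using F0(1) by (simp add: closed_Int_compact)
  have nF: "nowhere_dense (F i)" for i
    unfolding F_def using F0(2) nowhere_dense_subset by blast
  have mono: "F i \<subseteq> F j" if "i \<le> j" for i j
    using F0(3) that unfolding F_def incseq_def by fastforce
  have cover: "M \<subseteq> (\<Union>i. F i)"
  proof
    fix x assume "x \<in> M"
    then obtain i where i: "x \<in> F0 i" using F0(4) by blast
    obtain k where k: "norm x \<le> real k" using real_arch_simple by blast
    have "x \<in> F (max i k)"
      using i k incseqD[OF F0(3), of i "max i k"] unfolding F_def by auto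
    then show "x \<in> (\<Union>i. F i)" by blast
  qed
  have "\<forall>i \<delta>. \<exists>\<epsilon>. \<delta> > 0 \<longrightarrow> \<epsilon> > 0 \<and> \<epsilon> \<le> \<delta>/2 \<and>
      (\<forall>c. \<exists>c'. cball c' \<epsilon> \<subseteq> cball c \<delta> \<and> (\<forall>z\<in>cball c' \<epsilon>. \<forall>f\<in>F i. dist z f > \<epsilon>))"
    using nowhere_dense_uniform_holes[OF cF nF] by metis
  then obtain e where e: "\<And>i \<delta>. \<delta> > 0 \<Longrightarrow> e i \<delta> > 0" "\<And>i \<delta>. \<delta> > 0 \<Longrightarrow> e i \<delta> \<le> \<delta>/2"
    "\<And>i \<delta> c. \<delta> > 0 \<Longrightarrow> \<exists>c'. cball c' (e i \<delta>) \<subseteq> cball c \<delta> \<and>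
         (\<forall>z\<in>cball c' (e i \<delta>). \<forall>f\<in>F i. dist z f > e i \<delta>)"
    by metis
  \<comment> \<open>\<open>\<delta> (Suc i)\<close> is the uniform hole radius for
    \<open>F i\<close> in balls of radius \<open>\<delta> i\<close>. These radii, shifted by one,
    are the diameters demanded of the covers.\<close>
  define \<delta> where "\<delta> = rec_nat (1::real) e"
  have \<delta>Suc: "\<delta> (Suc i) = e i (\<delta> i)" for i by (simp add: \<delta>_def)
  have \<delta>0: "\<delta> i > 0" for i
    by (induction i) (auto simp: \<delta>Suc e(1), simp add: \<delta>_def)
  have \<delta>le: "\<delta> i \<le> (1/2)^i" for i
  proof (induction i)
    case (Suc i) then show ?case using e(2)[OF \<delta>0, of i i] by (simp add: \<delta>Suc)
  qed (simp add: \<delta>_def)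
  obtain A :: "nat \<Rightarrow> 'a set" where A: "X \<subseteq> (\<Union>m. A m)" "\<And>m. finely_covered (\<lambda>i. \<delta> (Suc i)) (A m)"
    using X[unfolded sigma_finely_coverable_def, rule_format, of "\<lambda>i. \<delta> (Suc i)"] \<delta>0 by auto
  define S where "S m i = {x + f |x f. x \<in> A m \<and> f \<in> F i}" for m i
  have nd: "nowhere_dense (S m i)" for m i
    unfolding nowhere_dense_def
  proof (rule ccontr)
    assume "interior (closure (S m i)) \<noteq> {}"
    then obtain c r where cr: "r > 0" "cball c r \<subseteq> closure (S m i)"
      by (meson ex_in_conv interior_subset mem_interior_cball)
    obtain q where q: "(1/2)^q < r" using real_arch_pow_inv[OF cr(1)] by fastforce
    \<comment> \<open>\<open>p \<ge> i\<close> gives \<open>F i \<subseteq> F (p + n)\<close>, and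
      \<open>p \<ge> q\<close> makes the starting radius \<open>\<delta> p\<close> at most
      \<open>r\<close>.\<close>
    define p where "p = max i q"
    have "\<delta> p \<le> (1/2)^p" by (rule \<delta>le)
    also have "\<dots> \<le> (1/2)^q" unfolding p_def by (intro power_decreasing) auto
    finally have dp: "\<delta> p \<le> r" using q by linarith
    obtain N U where U: "A m \<subseteq> (\<Union>j<N. U j)"
      "\<And>j x y. j < N \<Longrightarrow> x \<in> U j \<Longrightarrow> y \<in> U j \<Longrightarrow> dist x y \<le> \<delta> (Suc (p + j))"
      using A(2)[of m] unfolding finely_covered_def by metis
    have "\<exists>c'. cball c' (\<delta> (p + n)) \<subseteq> cball c r \<and>
        (\<forall>j<n. \<forall>u\<in>U j. \<forall>f\<in>F i. u + f \<notin> cball c' (\<delta> (p + n)))" if "n \<le> N" for n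
      using that
    proof (induction n)
      case 0
      then show ?case using dp by (intro exI[of _ c]) (auto simp: subset_cball)
    next
      case (Suc n)
      then obtain c1 where c1: "cball c1 (\<delta> (p + n)) \<subseteq> cball c r"
        "\<And>j u f. j<n \<Longrightarrow> u\<in>U j \<Longrightarrow> f\<in>F i \<Longrightarrow> u + f \<notin> cball c1 (\<delta> (p + n))"
        by force
      \<comment> \<open>A representative of \<open>U n\<close>; if \<open>U n\<close> is empty the
        value is arbitrary and there is nothing to avoid.\<close>
      define x where "x = (SOME x. x \<in> U n)"
      obtain c2 where c2: "cball c2 (\<delta> (Suc (p + n))) \<subseteq> cball (c1 - x) (\<delta> (p + n))"
        "\<And>z f. z\<in>cball c2 (\<delta> (Suc (p + n))) \<Longrightarrow> f\<in>F (p + n) \<Longrightarrow> dist z f > \<delta> (Suc (p + n))"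
        using e(3)[OF \<delta>0, of "p + n" "p + n" "c1 - x"] unfolding \<delta>Suc by blast
      have sub: "cball (c2 + x) (\<delta> (p + Suc n)) \<subseteq> cball c1 (\<delta> (p + n))"
      proof
        fix z assume "z \<in> cball (c2 + x) (\<delta> (p + Suc n))"
        then have "z - x \<in> cball c2 (\<delta> (Suc (p + n)))" by (simp add: dist_norm algebra_simps)
        then have "z - x \<in> cball (c1 - x) (\<delta> (p + n))" using c2(1) by blast
        then show "z \<in> cball c1 (\<delta> (p + n))" by (simp add: dist_norm)
      qed
      show ?case
      proof (intro exI[of _ "c2 + x"] conjI allI impI ballI)
        show "cball (c2 + x) (\<delta> (p + Suc n)) \<subseteq> cball c r" using sub c1(1) by blast
        fix j u f assume j: "j < Suc n" and u: "u \<in> U j" and f: "f \<in> F i"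
        show "u + f \<notin> cball (c2 + x) (\<delta> (p + Suc n))"
        proof (cases "j < n")
          case True then show ?thesis using c1(2) u f sub by blast
        next
          case False
          then have jn: "j = n" using j by simp
          then have "x \<in> U n" using u unfolding x_def by (metis someI)
          then have le: "dist u x \<le> \<delta> (Suc (p + n))" using U(2)[of n u x] u jn Suc.prems by simp
          show ?thesis
          proof
            assume "u + f \<in> cball (c2 + x) (\<delta> (p + Suc n))"
            then have "u + f - x \<in> cball c2 (\<delta> (Suc (p + n)))" by (simp add: dist_norm algebra_simps)
            moreover have "f \<in> F (p + n)" using f mono[of i "p + n"] unfolding p_def by (meson le_add1 max.cobounded1 order_trans subsetD)
            ultimately have "dist (u + f - x) f > \<delta> (Suc (p + n))" by (rule c2(2))
            then show False using le by (simp add: dist_norm)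
          qed
        qed
      qed
    qed
    from this[OF order_refl] obtain c' where c': "cball c' (\<delta> (p + N)) \<subseteq> cball c r"
        "\<forall>j<N. \<forall>u\<in>U j. \<forall>f\<in>F i. u + f \<notin> cball c' (\<delta> (p + N))"
      by (elim exE conjE)
    have "S m i \<inter> ball c' (\<delta> (p + N)) = {}"
    proof (rule equals0I)
      fix z assume z: "z \<in> S m i \<inter> ball c' (\<delta> (p + N))"
      then obtain u f j where "z = u + f" "f \<in> F i" "j < N" "u \<in> U j"
        using U(1) unfolding S_def by blast
      then show False using c'(2) z by force
    qed
    then have "closure (S m i) \<inter> ball c' (\<delta> (p + N)) = {}"
      by (metis inf_commute open_Int_closure_eq_empty open_ball)
    moreover have "c' \<in> ball c' (\<delta> (p + N))" using \<delta>0 by simp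
    moreover have "c' \<in> closure (S m i)" using c'(1) cr(2) \<delta>0[of "p + N"]
      by (meson centre_in_cball less_imp_le subsetD)
    ultimately show False by blast
  qed
  have "meager (\<Union>(range (\<lambda>(m, i). S m i)))"
    unfolding meager_def using nd by (intro exI[of _ "range (\<lambda>(m, i). S m i)"]) auto
  moreover have "{x + m |x m. x \<in> X \<and> m \<in> M} \<subseteq> \<Union>(range (\<lambda>(m, i). S m i))"
  proof clarsimp
    fix x m assume "x \<in> X" "m \<in> M"
    then obtain k i where "x \<in> A k" "m \<in> F i" using A(1) cover by blast
    then show "\<exists>a b. x + m \<in> S a b" unfolding S_def by blast
  qed
  ultimately show "meager {x + m |x m. x \<in> X \<and> m \<in> M}" by (rule meager_subset)
qed

section \<open>Sharp measure zero\<close>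

text \<open>Enumerate by decreasing weight: the \<open>j\<close>-th largest of the weights is at most \<open>1/j\<close> of their
  sum.\<close>

lemma enumerate_by_weight:
  fixes w :: "'i \<Rightarrow> real"
  assumes "finite I" "\<And>i. i \<in> I \<Longrightarrow> w i \<ge> 0" "sum w I < 1 / (real p + 1)"
  obtains e where "bij_betw e {..<card I} I" "\<And>j. j < card I \<Longrightarrow> w (e j) < 1 / (real (p + j) + 1)"
proof -
  have "\<exists>e. bij_betw e {..<card I} I \<and> (\<forall>j<card I. w (e j) < 1 / (real (p + j) + 1))"
    using assms
  proof (induction "card I" arbitrary: I)
    case 0
    then show ?case by (auto simp: bij_betw_def)
  next
    case (Suc n)
    then have "I \<noteq> {}" by auto
    \<comment> \<open>The least weight goes to the last position \<open>n\<close>; it is at most the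
      average of all \<open>n + 1\<close> weights.\<close>
    then obtain a where a: "a \<in> I" "\<And>i. i \<in> I \<Longrightarrow> w a \<le> w i"
      using Suc.prems(1) by (metis arg_min_if_finite(1) arg_min_least)
    let ?J = "I - {a}"
    have cJ: "card ?J = n" using Suc a by simp
    have "sum w ?J \<le> sum w I" using Suc.prems by (intro sum_mono2) auto
    then obtain e where e: "bij_betw e {..<n} ?J" "\<And>j. j<n \<Longrightarrow> w (e j) < 1 / (real (p + j) + 1)"
      using Suc.hyps(1)[of ?J] Suc.prems cJ by force
    define e' where "e' = e(n := a)"
    have "bij_betw e' {..<n} ?J"
      using e(1) by (rule bij_betw_cong[THEN iffD1, rotated]) (simp add: e'_def)
    moreover have "bij_betw e' {n} {a}" by (simp add: e'_def)
    ultimately have "bij_betw e' ({..<n} \<union> {n}) (?J \<union> {a})" by (rule bij_betw_combine) auto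
    then have bij: "bij_betw e' {..<card I} I" using Suc.hyps(2)[symmetric] a(1) by (simp add: insert_absorb lessThan_Suc)
    have "real (Suc n) * w a \<le> sum w I"
      using sum_bounded_below[of I "w a" w] a(2) Suc.hyps(2) by simp
    then have "real (Suc n) * w a < 1 / (real p + 1)" using Suc.prems(3) by linarith
    then have "w a < 1 / (real p + 1) / real (Suc n)"
      by (simp add: less_divide_eq mult.commute mult.left_commute del: of_nat_Suc)
    also have "\<dots> = 1 / ((real p + 1) * real (Suc n))" by simp
    also have "\<dots> \<le> 1 / (real (p + n) + 1)"
      by (intro divide_left_mono mult_pos_pos) (auto simp: algebra_simps)
    finally have "w a < 1 / (real (p + n) + 1)" .
    then have "\<forall>j<card I. w (e' j) < 1 / (real (p + j) + 1)"
      using e(2) Suc.hyps(2) unfolding e'_def by (auto simp: less_Suc_eq)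
    with bij show ?case by blast
  qed
  then show thesis using that by blast
qed

text \<open>By the last condition, a weight below \<open>1 / (q + 1)\<close> forces diameter at most
  \<open>\<epsilon> q\<close>. Sorting by weight puts a weight below \<open>1 / (p + j + 1)\<close>
  at position \<open>j\<close>. The weights will be diameters in a modified metric in one
  application and reciprocals of lattice point counts in the other.\<close>

lemma finely_coveredI_weights:
  assumes "\<And>p. \<exists>(I :: 'i set) (U :: 'i \<Rightarrow> 'a::metric_space set) w.
      finite I \<and> A \<subseteq> (\<Union>i\<in>I. U i) \<and> (\<forall>i\<in>I. w i \<ge> 0) \<and> sum w I < 1 / (real p + 1) \<and>
      (\<forall>i\<in>I. \<forall>q. \<forall>x\<in>U i. \<forall>y\<in>U i. dist x y > \<epsilon> q \<longrightarrow> w i \<ge> 1 / (real q + 1))"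
  shows "finely_covered \<epsilon> A"
  unfolding finely_covered_def
proof
  fix p
  obtain I :: "'i set" and U :: "'i \<Rightarrow> 'a::metric_space set" and w
    where I: "finite I" "A \<subseteq> (\<Union>i\<in>I. U i)" "\<forall>i\<in>I. w i \<ge> 0" "sum w I < 1 / (real p + 1)"
     and w: "\<forall>i\<in>I. \<forall>q. \<forall>x\<in>U i. \<forall>y\<in>U i. dist x y > \<epsilon> q \<longrightarrow> w i \<ge> 1 / (real q + 1)"
    using assms[of p] by (elim exE conjE)
  obtain e where e: "bij_betw e {..<card I} I" "\<And>j. j < card I \<Longrightarrow> w (e j) < 1 / (real (p + j) + 1)"
    using enumerate_by_weight[OF I(1) I(3)[rule_format] I(4)] by blast
  have eI: "e j \<in> I" if "j < card I" for j using e(1) that by (auto simp: bij_betw_def)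
  show "\<exists>N U. A \<subseteq> (\<Union>j<N. U j) \<and> (\<forall>j<N. \<forall>x\<in>U j. \<forall>y\<in>U j. dist x y \<le> \<epsilon> (p + j))"
  proof (intro exI conjI allI impI ballI)
    show "A \<subseteq> (\<Union>j<card I. (U \<circ> e) j)"
    proof
      fix x assume "x \<in> A"
      then obtain i where "i \<in> e ` {..<card I}" "x \<in> U i"
        using I(2) bij_betw_imp_surj_on[OF e(1)] by blast
      then show "x \<in> (\<Union>j<card I. (U \<circ> e) j)" by auto
    qed
    fix j x y assume "j < card I" "x \<in> (U \<circ> e) j" "y \<in> (U \<circ> e) j"
    then show "dist x y \<le> \<epsilon> (p + j)"
      using w[rule_format, OF eI, of j x y "p + j"] e(2)[of j] by fastforce
  qed
qed

text \<open>A point is determined by the set of indices of the basic open sets containing it, and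
  sets of naturals embed into the reals. This allows a copy of the space to live on another type of
  points.\<close>

lemma ex_inj_real:
  obtains j :: "'a::{second_countable_topology, t2_space} \<Rightarrow> real" where "inj j"
proof -
  obtain B :: "'a set set" where B: "countable B" "topological_basis B"
    using ex_countable_basis by blast
  define b where "b = from_nat_into B"
  have Bne: "B \<noteq> {}" using B(2) unfolding topological_basis_def by (metis Sup_subset_mono UNIV_not_empty Union_empty bot.extremum open_UNIV subset_empty)
  have rb: "range b = B" unfolding b_def using B Bne by (simp add: range_from_nat_into)
  define s where "s x = {n. x \<in> b n}" for x
  have "inj s"
  proof (rule injI, rule ccontr)
    fix x y assume eq: "s x = s y" and "x \<noteq> y"
    then obtain V where V: "open V" "x \<in> V" "y \<notin> V" using separation_t2[of x y] by blast
    then obtain W where "W \<in> B" "x \<in> W" "W \<subseteq> V" using B(2) topological_basisE by blast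
    then obtain n where "n \<in> s x" "n \<notin> s y" using V rb unfolding s_def by (metis imageE mem_Collect_eq subsetD)
    then show False using eq by simp
  qed
  obtain g :: "nat set \<Rightarrow> real" where "inj g"
    using nat_sets_lepoll_reals01 unfolding lepoll_def by blast
  then have "inj (g \<circ> s)" using \<open>inj s\<close> inj_compose by blast
  then show thesis by (rule that)
qed

section \<open>A slowly vanishing gauge and the metric it induces\<close>

text \<open>This is the function \<open>\<phi>\<close> that turns the distance into a new metric.
  Each term is subadditive on nonnegative arguments, hence so is the supremum; the factors
  \<open>1 / (i + 1)\<close> make it tend to 0 at 0 however fast \<open>\<epsilon>\<close>
  decreases, yet it is at least \<open>1 / (i + 1)\<close> from \<open>\<epsilon> i\<close>
  on.\<close>

definition gauge_sup :: "(nat \<Rightarrow> real) \<Rightarrow> real \<Rightarrow> real" where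
  "gauge_sup \<epsilon> t = (SUP i. min 1 (t / \<epsilon> i) / (real i + 1))"

context
  fixes \<epsilon> :: "nat \<Rightarrow> real"
  assumes \<epsilon>: "\<And>i. \<epsilon> i > 0"
begin

lemma bdd_above_gauge_sup: "bdd_above (range (\<lambda>i. min 1 (t / \<epsilon> i) / (real i + 1)))"
proof (rule bdd_aboveI2)
  fix i
  show "min 1 (t / \<epsilon> i) / (real i + 1) \<le> 1" by (auto simp: divide_le_eq)
qed

lemma gauge_sup_upper: "min 1 (t / \<epsilon> i) / (real i + 1) \<le> gauge_sup \<epsilon> t"
  unfolding gauge_sup_def by (rule cSUP_upper[OF _ bdd_above_gauge_sup]) simp

lemma gauge_sup_0: "gauge_sup \<epsilon> 0 = 0"
  unfolding gauge_sup_def by simp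

lemma gauge_sup_mono: "s \<le> t \<Longrightarrow> gauge_sup \<epsilon> s \<le> gauge_sup \<epsilon> t"
  unfolding gauge_sup_def
proof (rule cSUP_mono[OF _ bdd_above_gauge_sup])
  fix i assume "s \<le> t"
  then have "min 1 (s / \<epsilon> i) / (real i + 1) \<le> min 1 (t / \<epsilon> i) / (real i + 1)"
    using divide_right_mono[of s t "\<epsilon> i"] \<epsilon>[of i] by (intro divide_right_mono) auto
  then show "\<exists>k\<in>UNIV. min 1 (s / \<epsilon> i) / (real i + 1) \<le> min 1 (t / \<epsilon> k) / (real k + 1)" by blast
qed simp

lemma gauge_sup_ge: "t \<ge> \<epsilon> i \<Longrightarrow> gauge_sup \<epsilon> t \<ge> 1 / (real i + 1)"
  using gauge_sup_upper[of t i] \<epsilon>[of i] by (simp add: le_divide_eq min_def split: if_splits)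

lemma gauge_sup_pos: "t > 0 \<Longrightarrow> gauge_sup \<epsilon> t > 0"
  using gauge_sup_upper[of t 0] \<epsilon>[of 0]
  by (smt (verit) divide_pos_pos of_nat_0_le_iff)

lemma gauge_sup_subadditive:
  assumes "s \<ge> 0" "t \<ge> 0"
  shows "gauge_sup \<epsilon> (s + t) \<le> gauge_sup \<epsilon> s + gauge_sup \<epsilon> t"
  unfolding gauge_sup_def[of \<epsilon> "s + t"]
proof (rule cSUP_least)
  fix i
  have "min 1 ((s + t) / \<epsilon> i) \<le> min 1 (s / \<epsilon> i) + min 1 (t / \<epsilon> i)"
    using divide_nonneg_pos[OF assms(1) \<epsilon>[of i]] divide_nonneg_pos[OF assms(2) \<epsilon>[of i]]
    unfolding add_divide_distrib by linarith
  then have "min 1 ((s + t) / \<epsilon> i) / (real i + 1) \<le>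
      min 1 (s / \<epsilon> i) / (real i + 1) + min 1 (t / \<epsilon> i) / (real i + 1)"
    by (metis add_divide_distrib divide_right_mono of_nat_0_le_iff add_nonneg_nonneg zero_le_one)
  also have "\<dots> \<le> gauge_sup \<epsilon> s + gauge_sup \<epsilon> t" by (intro add_mono gauge_sup_upper)
  finally show "min 1 ((s + t) / \<epsilon> i) / (real i + 1) \<le> gauge_sup \<epsilon> s + gauge_sup \<epsilon> t" .
qed simp

text \<open>Terms with index above \<open>N\<close> are at most \<open>1 / (N + 1)\<close> for every
  argument, and the finitely many others are small for small \<open>t\<close>.\<close>

lemma gauge_sup_small:
  assumes "\<eta> > 0"
  obtains t where "t > 0" "\<And>s. s < t \<Longrightarrow> gauge_sup \<epsilon> s < \<eta>"
proof -
  obtain N where N: "1 / (real N + 1) < \<eta>/2"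
    using assms by (metis half_gt_zero inverse_eq_divide of_nat_Suc add.commute reals_Archimedean)
  define t where "t = Min ((\<lambda>i. \<epsilon> i * \<eta> / 2) ` {..N})"
  have t: "t > 0" unfolding t_def using \<epsilon> assms by auto
  have tle: "t \<le> \<epsilon> i * \<eta>/2" if "i \<le> N" for i unfolding t_def using that by (intro Min_le) auto
  have "gauge_sup \<epsilon> t \<le> \<eta>/2"
    unfolding gauge_sup_def
  proof (rule cSUP_least)
    fix i
    show "min 1 (t / \<epsilon> i) / (real i + 1) \<le> \<eta>/2"
    proof (cases "i \<le> N")
      case True
      have "min 1 (t / \<epsilon> i) / (real i + 1) \<le> t / \<epsilon> i / 1"
        using t \<epsilon>[of i] by (intro frac_le) (auto simp: less_imp_le)
      also have "\<dots> \<le> \<eta>/2" using tle[OF True] \<epsilon>[of i] by (simp add: divide_le_eq mult.commute)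
      finally show ?thesis .
    next
      case False
      have "min 1 (t / \<epsilon> i) / (real i + 1) \<le> 1 / (real N + 1)"
        using False by (intro frac_le) auto
      then show ?thesis using N by linarith
    qed
  qed simp
  then have "gauge_sup \<epsilon> s < \<eta>" if "s < t" for s
    using gauge_sup_mono[of s t] that assms by linarith
  then show thesis using t that by blast
qed

end

text \<open>The bound by \<open>\<delta>\<close> makes the diameter finite; \<open>enn2real\<close>
  would send an infinite one to 0.\<close>

lemma mdist_le_mdiam:
  assumes "x \<in> A" "y \<in> A" "mdiam Y A \<le> ennreal \<delta>"
  shows "mdist Y x y \<le> enn2real (mdiam Y A)"
proof -
  have "ennreal (mdist Y x y) \<le> mdiam Y A"
    unfolding mdiam_def using assms by (meson SUP_upper2 order_refl)
  moreover have "mdiam Y A < top" using assms(3) ennreal_less_top le_less_trans by blast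
  ultimately show ?thesis using enn2real_mono by (fastforce simp: enn2real_ennreal)
qed

text \<open>The target is a copy of the whole space on \<open>range j\<close> with metric
  \<open>\<phi> (dist x y)\<close>, which is complete and into which \<open>j\<close> is uniformly
  continuous. Vanishing Hausdorff measure of exponent below 1 gives covers with small diameter sum;
  slightly enlarged to open sets they have finite subcovers on compact pieces, and the diameters
  serve as weights.\<close>

lemma sharp_measure_zero_imp_sigma_finely_coverable:
  fixes X :: "'a::euclidean_space set" and j :: "'a \<Rightarrow> 'c"
  assumes sharp: "sharp_measure_zero TYPE('c) (submetric euclidean_metric X)" and "inj j"
  shows "sigma_finely_coverable X"
  unfolding sigma_finely_coverable_def
proof (intro allI impI)
  fix \<epsilon> :: "nat \<Rightarrow> real" assume "\<forall>i. \<epsilon> i > 0"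
  then have \<epsilon>: "\<And>i. \<epsilon> i > 0" by blast
  define v where "v = inv j"
  have vj [simp]: "v (j x) = x" for x using \<open>inj j\<close> by (simp add: v_def)
  define d where "d a b = gauge_sup \<epsilon> (dist (v a) (v b))" for a b
  interpret Y: Metric_space "range j" d
  proof
    fix a b c assume abc: "a \<in> range j" "b \<in> range j" "c \<in> range j"
    show "d a b = 0 \<longleftrightarrow> a = b"
    proof
      assume "d a b = 0"
      then have "\<not> dist (v a) (v b) > 0"
        using gauge_sup_pos[of \<epsilon> "dist (v a) (v b)", OF \<epsilon>] unfolding d_def by linarith
      then have "v a = v b" by simp
      moreover have "j (v a) = a" "j (v b) = b" using abc by auto
      ultimately show "a = b" by metis
    qed (simp add: d_def gauge_sup_0[of \<epsilon>, OF \<epsilon>])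
    have "dist (v a) (v c) \<le> dist (v a) (v b) + dist (v b) (v c)" by (rule dist_triangle)
    then show "d a c \<le> d a b + d b c"
      unfolding d_def
      using gauge_sup_mono[of \<epsilon> "dist (v a) (v c)", OF \<epsilon>]
        gauge_sup_subadditive[of \<epsilon> "dist (v a) (v b)" "dist (v b) (v c)", OF \<epsilon>]
      by fastforce
  next
    fix a b :: 'c
    show "0 \<le> d a b" unfolding d_def
      using gauge_sup_mono[of \<epsilon>, OF \<epsilon>, of 0 "dist (v a) (v b)"] gauge_sup_0[of \<epsilon>, OF \<epsilon>] by simp
    show "d a b = d b a" by (simp add: d_def dist_commute)
  qed
  let ?Y = "metric (range j, d)"
  have small: "\<exists>t>0. \<forall>x y. dist x y < t \<longrightarrow> d (j x) (j y) < \<eta>" if "\<eta> > 0" for \<eta>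
  proof -
    obtain t where "t > 0" "\<And>s. s < t \<Longrightarrow> gauge_sup \<epsilon> s < \<eta>"
      using gauge_sup_small[of \<epsilon>, OF \<epsilon> \<open>\<eta> > 0\<close>] by metis
    then show ?thesis unfolding d_def by auto
  qed
  have complete: "Y.mcomplete"
    unfolding Y.mcomplete_def
  proof (intro allI impI)
    fix \<sigma> assume \<sigma>: "Y.MCauchy \<sigma>"
    have rng: "j (v (\<sigma> n)) = \<sigma> n" for n
      using \<sigma> unfolding Y.MCauchy_def by (metis vj imageE range_subsetD)
    have "Cauchy (\<lambda>n. v (\<sigma> n))"
      unfolding Cauchy_def
    proof (intro allI impI)
      fix r :: real assume "r > 0"
      \<comment> \<open>By monotonicity of the gauge, a value below
        \<open>gauge_sup \<epsilon> r\<close> forces a distance below \<open>r\<close>.\<close>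
      then obtain N where N: "\<And>m n. m \<ge> N \<Longrightarrow> n \<ge> N \<Longrightarrow> d (\<sigma> m) (\<sigma> n) < gauge_sup \<epsilon> r"
        using \<sigma> gauge_sup_pos[of \<epsilon>, OF \<epsilon>] unfolding Y.MCauchy_def by metis
      have "dist (v (\<sigma> m)) (v (\<sigma> n)) < r" if "m \<ge> N" "n \<ge> N" for m n
        using N[OF that] gauge_sup_mono[of \<epsilon>, OF \<epsilon>, of r "dist (v (\<sigma> m)) (v (\<sigma> n))"]
        unfolding d_def by linarith
      then show "\<exists>N. \<forall>m\<ge>N. \<forall>n\<ge>N. dist (v (\<sigma> m)) (v (\<sigma> n)) < r" by blast
    qed
    then obtain l where l: "(\<lambda>n. v (\<sigma> n)) \<longlonglongrightarrow> l"
      using Cauchy_convergent_iff convergent_def by blast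
    have "limitin Y.mtopology \<sigma> (j l) sequentially"
      unfolding Y.limit_metric_sequentially
    proof (intro conjI allI impI)
      fix \<eta> :: real assume "\<eta> > 0"
      then obtain t where t: "t > 0" "\<And>x y. dist x y < t \<Longrightarrow> d (j x) (j y) < \<eta>"
        using small by blast
      then obtain N where "\<forall>n\<ge>N. dist (v (\<sigma> n)) l < t" using l by (meson LIMSEQ_def)
      then have "\<forall>n\<ge>N. \<sigma> n \<in> range j \<and> d (\<sigma> n) (j l) < \<eta>" using t(2) rng by (metis rangeI)
      then show "\<exists>N. \<forall>n\<ge>N. \<sigma> n \<in> range j \<and> d (\<sigma> n) (j l) < \<eta>" by blast
    qed simp
    then show "\<exists>x. limitin Y.mtopology \<sigma> x sequentially" by blast
  qed
  have ucont: "uniformly_continuous_map (submetric euclidean_metric X) ?Y j"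
    unfolding uniformly_continuous_map_def
  proof (intro conjI allI impI)
    fix \<eta> :: real assume "\<eta> > 0"
    then show "\<exists>\<delta>>0. \<forall>x\<in>mspace (submetric euclidean_metric X). \<forall>y\<in>mspace (submetric euclidean_metric X).
        mdist (submetric euclidean_metric X) y x < \<delta> \<longrightarrow> mdist ?Y (j y) (j x) < \<eta>"
      using small[of \<eta>] by auto
  qed auto
  obtain K where K: "sigma_compact_in Y.mtopology K" "j ` X \<subseteq> K" "hausdorff_dim ?Y K = 0"
    using sharp complete ucont unfolding sharp_measure_zero_def
    by (metis Y.mcomplete_of Y.mtopology_of mspace_submetric mspace_euclidean_metric inf_top_right)
  then obtain \<C> where \<C>: "countable \<C>" "\<And>C. C \<in> \<C> \<Longrightarrow> compactin Y.mtopology C" "K = \<Union>\<C>"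
    unfolding sigma_compact_in_def by blast
  define Q where "Q = from_nat_into (insert {} \<C>)"
  have rQ: "range Q = insert {} \<C>"
    unfolding Q_def using \<C>(1) by (intro range_from_nat_into) auto
  then have cQ: "compactin Y.mtopology (Q m)" for m
    using \<C>(2) by (metis compactin_empty insert_iff rangeI)
  have QK: "Q m \<subseteq> K" for m using rQ \<C>(3) by (metis Sup_upper empty_subsetI insert_iff rangeI)
  \<comment> \<open>An exponent below 1 gives \<open>D k \<le> D k powr s\<close> for diameters at
    most 1, so a small sum of powers bounds the plain sum of diameters.\<close>
  obtain s where s: "s > 0" "s < 1" "hausdorff_measure ?Y s K = 0"
  proof -
    have "Inf {ennreal s |s. s > 0 \<and> hausdorff_measure ?Y s K = 0} < 1"
      using K(3) unfolding hausdorff_dim_def by simp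
    then obtain s where "s > 0" "hausdorff_measure ?Y s K = 0" "ennreal s < 1"
      unfolding Inf_less_iff by blast
    then show thesis using that by (metis ennreal_1 ennreal_less_iff less_imp_le)
  qed
  have fine: "finely_covered \<epsilon> (v ` Q m)" for m
  proof (rule finely_coveredI_weights[where 'i = nat])
    fix p
    \<comment> \<open>Half of the allowed \<open>1 / (p + 1)\<close>: one half for the diameters,
      the other for the enlargement to open sets.\<close>
    define \<eta> :: real where "\<eta> = 1 / (2 * (real p + 1))"
    have \<eta>: "\<eta> > 0" unfolding \<eta>_def by simp
    let ?\<CC> = "{C :: nat \<Rightarrow> 'c set. K \<subseteq> (\<Union>k. C k) \<and>
                 (\<forall>k. C k \<subseteq> mspace ?Y \<and> mdiam ?Y (C k) \<le> ennreal 1)}"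
    have "(INF C\<in>?\<CC>. (\<Sum>k. ennreal (enn2real (mdiam ?Y (C k)) powr s))) \<le> hausdorff_measure ?Y s K"
      unfolding hausdorff_measure_def by (rule SUP_upper) simp
    then have "(INF C\<in>?\<CC>. (\<Sum>k. ennreal (enn2real (mdiam ?Y (C k)) powr s))) < ennreal \<eta>"
      using s(3) \<eta> by (simp add: le_zero_eq)
    then obtain C where C: "C \<in> ?\<CC>" "(\<Sum>k. ennreal (enn2real (mdiam ?Y (C k)) powr s)) < ennreal \<eta>"
      unfolding INF_less_iff by blast
    define D where "D k = enn2real (mdiam ?Y (C k))" for k
    have D: "D k \<ge> 0" "D k \<le> 1" for k
    proof -
      show "D k \<ge> 0" by (simp add: D_def)
      have "mdiam ?Y (C k) \<le> ennreal 1" using C(1) by blast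
      then show "D k \<le> 1" unfolding D_def using enn2real_leI by force
    qed
    have CY: "C k \<subseteq> range j" for k using C(1) by auto
    have Cd: "d x y \<le> D k" if "x \<in> C k" "y \<in> C k" for x y k
      using mdist_le_mdiam[OF that, of ?Y 1] C(1) unfolding D_def by auto
    \<comment> \<open>Enlarging \<open>C k\<close> by \<open>\<theta> k\<close> adds at most
      \<open>2 * \<theta> k\<close> to its diameter, and these increments sum to at most
      \<open>\<eta>\<close>.\<close>
    define \<theta> where "\<theta> k = \<eta> * (1/2)^(k+2)" for k :: nat
    have \<theta>: "\<theta> k > 0" for k using \<eta> by (simp add: \<theta>_def)
    define O' where "O' k = (\<Union>c\<in>C k. Y.mball c (\<theta> k))" for k
    have openO: "openin Y.mtopology (O' k)" for k
      unfolding O'_def by (intro openin_Union) auto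
    have "Q m \<subseteq> (\<Union>k. O' k)"
    proof
      fix y assume "y \<in> Q m"
      then obtain k where k: "y \<in> C k" using QK C(1) by blast
      then have "y \<in> Y.mball y (\<theta> k)" using CY[of k] \<theta>[of k] Y.centre_in_mball_iff by blast
      then show "y \<in> (\<Union>k. O' k)" using k unfolding O'_def by blast
    qed
    then obtain \<F> where \<F>: "finite \<F>" "\<F> \<subseteq> range O'" "Q m \<subseteq> \<Union>\<F>"
      using compactinD[OF cQ, of "range O'" m] openO by blast
    then obtain I where I: "finite I" "Q m \<subseteq> (\<Union>k\<in>I. O' k)"
      by (metis finite_subset_image)
    define w where "w k = D k + 2 * \<theta> k" for k
    have Od: "d x y \<le> w k" if xy: "x \<in> O' k" "y \<in> O' k" for x y k
    proof -
      obtain a b where ab: "a \<in> C k" "x \<in> Y.mball a (\<theta> k)" "b \<in> C k" "y \<in> Y.mball b (\<theta> k)"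
        using xy unfolding O'_def by blast
      then have "d x y \<le> d x a + d a b + d b y"
        by (metis CY Y.triangle Y.in_mball add_right_mono order_trans subsetD)
      then show ?thesis using ab Cd[OF ab(1,3)] Y.commute[of x a] unfolding w_def by simp
    qed
    have "sum D I \<le> (\<Sum>k\<in>I. D k powr s)"
    proof (rule sum_mono)
      fix k
      show "D k \<le> D k powr s"
        using D[of k] powr_mono'[of s 1 "D k"] s by (cases "D k = 0") auto
    qed
    also have "\<dots> < \<eta>"
    proof -
      have "ennreal (\<Sum>k\<in>I. D k powr s) = (\<Sum>k\<in>I. ennreal (D k powr s))" by simp
      also have "\<dots> \<le> (\<Sum>k. ennreal (D k powr s))" using I(1) by (intro sum_le_suminf) auto
      also have "\<dots> < ennreal \<eta>" using C(2) unfolding D_def .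
      finally show ?thesis using \<eta> by (simp add: ennreal_less_iff sum_nonneg)
    qed
    finally have sD: "sum D I < \<eta>" .
    have sm: "(\<lambda>k. \<eta> * (1/2)^Suc k) sums (\<eta> * 1)"
      by (intro sums_mult power_half_series)
    have "(\<Sum>k\<in>I. 2 * \<theta> k) = (\<Sum>k\<in>I. \<eta> * (1/2)^Suc k)" by (simp add: \<theta>_def)
    also have "\<dots> \<le> (\<Sum>k. \<eta> * (1/2)^Suc k)"
      using \<eta> by (intro sum_le_suminf[OF sums_summable[OF sm] I(1)]) auto
    also have "\<dots> = \<eta>" using sums_unique[OF sm] by simp
    finally have s\<theta>: "(\<Sum>k\<in>I. 2 * \<theta> k) \<le> \<eta>" .
    have sw: "sum w I < 1 / (real p + 1)"
      using sD s\<theta> unfolding w_def sum.distrib \<eta>_def by (simp add: field_simps)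
    show "\<exists>(I :: nat set) U w.
      finite I \<and> v ` Q m \<subseteq> (\<Union>i\<in>I. U i) \<and> (\<forall>i\<in>I. w i \<ge> 0) \<and> sum w I < 1 / (real p + 1) \<and>
      (\<forall>i\<in>I. \<forall>q. \<forall>x\<in>U i. \<forall>y\<in>U i. dist x y > \<epsilon> q \<longrightarrow> w i \<ge> 1 / (real q + 1))"
    proof (intro exI conjI ballI allI impI)
      show "finite I" by fact
      show "v ` Q m \<subseteq> (\<Union>i\<in>I. v ` O' i)" using I(2) by blast
      show "w k \<ge> 0" for k using D \<theta>[of k] unfolding w_def by (simp add: add_nonneg_nonneg less_imp_le)
      show "sum w I < 1 / (real p + 1)" by fact
      fix k q x y assume "x \<in> v ` O' k" "y \<in> v ` O' k" and gt: "dist x y > \<epsilon> q"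
      then obtain a b where ab: "a \<in> O' k" "b \<in> O' k" "x = v a" "y = v b" by blast
      have "1 / (real q + 1) \<le> d a b"
        unfolding d_def using gauge_sup_ge[of \<epsilon>, OF \<epsilon>, of q] gt ab by simp
      then show "1 / (real q + 1) \<le> w k" using Od[OF ab(1,2)] by linarith
    qed
  qed
  moreover have "X \<subseteq> (\<Union>m. v ` Q m)"
  proof
    fix x assume "x \<in> X"
    then obtain C where "C \<in> \<C>" "j x \<in> C" using K(2) \<C>(3) by blast
    then obtain m where "j x \<in> Q m" using rQ by (metis insertI2 imageE)
    then show "x \<in> (\<Union>m. v ` Q m)" by (metis UNIV_I UN_I image_eqI vj)
  qed
  ultimately show "\<exists>A :: nat \<Rightarrow> 'a set. X \<subseteq> (\<Union>m. A m) \<and> (\<forall>m. finely_covered \<epsilon> (A m))"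
    by blast
qed

section \<open>From fine covers to sharp measure zero\<close>

lemma mdiam_le:
  assumes "\<And>x y. x \<in> A \<Longrightarrow> y \<in> A \<Longrightarrow> mdist Y x y \<le> r"
  shows "mdiam Y A \<le> ennreal r"
  unfolding mdiam_def by (intro SUP_least ennreal_leI assms)

text \<open>Points of the closure are within \<open>e/2\<close> of points of \<open>A\<close>, so
  the bound grows by at most \<open>e\<close>. It lets covers of an image be replaced by covers of
  its closure.\<close>

lemma (in Metric_space) closure_of_mdist_le:
  assumes "\<And>x y. x \<in> A \<Longrightarrow> y \<in> A \<Longrightarrow> d x y \<le> r"
    and "x \<in> mtopology closure_of A" "y \<in> mtopology closure_of A"
  shows "d x y \<le> r"
proof (rule field_le_epsilon)
  fix e :: real assume "e > 0"
  then have "e/2 > 0" by simp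
  then obtain a b where ab: "a \<in> A" "a \<in> mball x (e/2)" "b \<in> A" "b \<in> mball y (e/2)"
    using assms(2,3) unfolding metric_closure_of by blast
  then have M: "a \<in> M" "b \<in> M" "x \<in> M" "y \<in> M" by auto
  then have "d x y \<le> d x a + d a b + d b y"
    by (meson add_right_mono order_trans triangle)
  then show "d x y \<le> r + e" using ab assms(1)[of a b] commute[of b y] M by simp
qed

lemma hausdorff_measure_eq_0I:
  assumes "\<And>\<delta> \<eta>. \<delta> > 0 \<Longrightarrow> \<eta> > 0 \<Longrightarrow> \<exists>C :: nat \<Rightarrow> 'b set. E \<subseteq> (\<Union>k. C k) \<and>
        (\<forall>k. C k \<subseteq> mspace Y \<and> mdiam Y (C k) \<le> ennreal \<delta>) \<and>
        (\<Sum>k. ennreal (enn2real (mdiam Y (C k)) powr s)) \<le> ennreal \<eta>"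
  shows "hausdorff_measure (Y :: 'b metric) s E = 0"
proof -
  have "(INF C\<in>{C. E \<subseteq> (\<Union>k. C k) \<and> (\<forall>k. C k \<subseteq> mspace Y \<and> mdiam Y (C k) \<le> ennreal \<delta>)}.
          (\<Sum>k::nat. ennreal (enn2real (mdiam Y (C k)) powr s))) \<le> 0" if \<delta>: "\<delta> > 0" for \<delta> :: real
  proof (rule ennreal_le_epsilon)
    fix \<eta> :: real assume "\<eta> > 0"
    then obtain C where "E \<subseteq> (\<Union>k. C k)" "\<forall>k. C k \<subseteq> mspace Y \<and> mdiam Y (C k) \<le> ennreal \<delta>"
        "(\<Sum>k::nat. ennreal (enn2real (mdiam Y (C k)) powr s)) \<le> ennreal \<eta>"
      using assms[OF \<delta>] by blast
    then show "(INF C\<in>{C. E \<subseteq> (\<Union>k. C k) \<and> (\<forall>k. C k \<subseteq> mspace Y \<and> mdiam Y (C k) \<le> ennreal \<delta>)}.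
          (\<Sum>k::nat. ennreal (enn2real (mdiam Y (C k)) powr s))) \<le> 0 + ennreal \<eta>"
      by (intro INF_lower2[of C]) auto
  qed
  then have "hausdorff_measure Y s E \<le> 0"
    unfolding hausdorff_measure_def by (intro SUP_least) auto
  then show ?thesis by simp
qed

lemma hausdorff_dim_eq_0I:
  assumes "\<And>s. s > 0 \<Longrightarrow> hausdorff_measure Y s E = 0"
  shows "hausdorff_dim Y E = 0"
proof -
  have "hausdorff_dim Y E \<le> 0"
  proof (rule ennreal_le_epsilon)
    fix s :: real assume "s > 0"
    then show "hausdorff_dim Y E \<le> 0 + ennreal s"
      unfolding hausdorff_dim_def using assms by (auto intro!: Inf_lower)
  qed
  then show ?thesis by simp
qed

text \<open>With \<open>\<epsilon> i\<close> a modulus of continuity for \<open>(1/2)^i\<close>, the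
  images of the covers have diameters at most \<open>(1/2)^(p + j)\<close>. Hence the image of each
  piece is totally bounded, its closure is compact by completeness, and for every exponent the cover
  sums are geometric tails that vanish as \<open>p\<close> grows.\<close>

lemma sigma_finely_coverable_imp_sharp_measure_zero:
  fixes X :: "'a::metric_space set"
  assumes X: "sigma_finely_coverable X"
  shows "sharp_measure_zero TYPE('c) (submetric euclidean_metric X)"
  unfolding sharp_measure_zero_def
proof (intro allI impI, elim conjE)
  fix Y :: "'c metric" and f
  assume comp: "mcomplete_of Y" and uc: "uniformly_continuous_map (submetric euclidean_metric X) Y f"
  interpret Y: Metric_space "mspace Y" "mdist Y" by (rule Metric_space_mspace_mdist)
  have mt: "Y.mtopology = mtopology_of Y" by (simp add: mtopology_of_def)
  have fY: "f x \<in> mspace Y" if "x \<in> X" for x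
    using uc that unfolding uniformly_continuous_map_def by auto
  have "\<forall>i. \<exists>\<delta>>0. \<forall>x\<in>X. \<forall>y\<in>X. dist x y \<le> \<delta> \<longrightarrow> mdist Y (f x) (f y) \<le> (1/2)^i"
  proof
    fix i :: nat
    obtain \<delta> where \<delta>: "\<delta> > 0" "\<And>x y. x\<in>X \<Longrightarrow> y\<in>X \<Longrightarrow> dist x y < \<delta> \<Longrightarrow> mdist Y (f x) (f y) < (1/2)^i"
      using uc unfolding uniformly_continuous_map_def
      by (metis Int_iff iso_tuple_UNIV_I mdist_euclidean_metric mdist_submetric mspace_euclidean_metric
          mspace_submetric half_gt_zero_iff zero_less_one zero_less_power)
    show "\<exists>\<delta>>0. \<forall>x\<in>X. \<forall>y\<in>X. dist x y \<le> \<delta> \<longrightarrow> mdist Y (f x) (f y) \<le> (1/2)^i"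
      using \<delta> by (intro exI[of _ "\<delta>/2"]) (auto intro!: less_imp_le[OF \<delta>(2)])
  qed
  then obtain \<epsilon> where \<epsilon>: "\<And>i. \<epsilon> i > 0"
    "\<And>i x y. x\<in>X \<Longrightarrow> y\<in>X \<Longrightarrow> dist x y \<le> \<epsilon> i \<Longrightarrow> mdist Y (f x) (f y) \<le> (1/2)^i"
    by metis
  obtain A :: "nat \<Rightarrow> 'a set" where A: "X \<subseteq> (\<Union>m. A m)" "\<And>m. finely_covered \<epsilon> (A m)"
    using X[unfolded sigma_finely_coverable_def, rule_format, of \<epsilon>] \<epsilon>(1) by auto
  have "\<exists>N V. f ` (A m \<inter> X) \<subseteq> (\<Union>j<N. V j) \<and> (\<forall>j<N. V j \<subseteq> mspace Y) \<and>
      (\<forall>j<N. \<forall>x\<in>V j. \<forall>y\<in>V j. mdist Y x y \<le> (1/2)^(p + j))" for m p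
  proof -
    obtain N U where U: "A m \<subseteq> (\<Union>j<N. U j)" "\<And>j x y. j<N \<Longrightarrow> x\<in>U j \<Longrightarrow> y\<in>U j \<Longrightarrow> dist x y \<le> \<epsilon> (p + j)"
      using A(2)[of m] unfolding finely_covered_def by metis
    show ?thesis
    proof (intro exI[of _ N] exI[of _ "\<lambda>j. f ` (U j \<inter> X)"] conjI allI impI ballI)
      show "f ` (A m \<inter> X) \<subseteq> (\<Union>j<N. f ` (U j \<inter> X))"
        unfolding image_UN[symmetric] Int_UN_distrib2[symmetric] using U(1) by blast
      show "f ` (U j \<inter> X) \<subseteq> mspace Y" for j using fY by auto
      fix j x y assume "j < N" "x \<in> f ` (U j \<inter> X)" "y \<in> f ` (U j \<inter> X)"
      then show "mdist Y x y \<le> (1/2)^(p + j)" by (auto intro: \<epsilon>(2) U(2))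
    qed
  qed
  then obtain N V where NV: "\<And>m p. f ` (A m \<inter> X) \<subseteq> (\<Union>j<N m p. V m p j)"
      "\<And>m p j. j<N m p \<Longrightarrow> V m p j \<subseteq> mspace Y"
      "\<And>m p j x y. j<N m p \<Longrightarrow> x\<in>V m p j \<Longrightarrow> y\<in>V m p j \<Longrightarrow> mdist Y x y \<le> (1/2)^(p + j)"
    by metis
  define L where "L m = Y.mtopology closure_of (f ` (A m \<inter> X))" for m
  \<comment> \<open>The pieces of \<open>K\<close> are closures, so the covering sets are closed up
    too. Beyond \<open>N m p\<close> they are padded by empty sets, which contribute 0.\<close>
  define W where "W m p j = (if j < N m p then Y.mtopology closure_of (V m p j) else {})" for m p j
  have W: "W m p j \<subseteq> mspace Y" "mdiam Y (W m p j) \<le> ennreal ((1/2)^(p + j))" for m p j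
  proof -
    show "W m p j \<subseteq> mspace Y"
      unfolding W_def using closure_of_subset_topspace[of Y.mtopology] by simp
    show "mdiam Y (W m p j) \<le> ennreal ((1/2)^(p + j))"
    proof (rule mdiam_le)
      fix x y assume "x \<in> W m p j" "y \<in> W m p j"
      then show "mdist Y x y \<le> (1/2)^(p + j)"
        using Y.closure_of_mdist_le[of "V m p j" "(1/2)^(p + j)" x y] NV(3)
        unfolding W_def by (auto split: if_splits)
    qed
  qed
  have LW: "L m \<subseteq> (\<Union>j. W m p j)" for m p
  proof -
    have "L m \<subseteq> Y.mtopology closure_of (\<Union>j<N m p. V m p j)"
      unfolding L_def by (intro closure_of_mono NV(1))
    also have "\<dots> = (\<Union>j<N m p. Y.mtopology closure_of (V m p j))"
      by (subst closure_of_Union) auto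
    also have "\<dots> \<subseteq> (\<Union>j. W m p j)" unfolding W_def by fastforce
    finally show ?thesis .
  qed
  have compact: "compactin Y.mtopology (L m)" for m
  proof -
    have "Y.mtotally_bounded (f ` (A m \<inter> X))"
      unfolding Y.mtotally_bounded_def
    proof (intro allI impI)
      fix e :: real assume "e > 0"
      then obtain p where p: "(1/2)^p < e" using real_arch_pow_inv[of e "1/2"] by auto
      let ?S = "f ` (A m \<inter> X)"
      \<comment> \<open>Total boundedness asks for centres in \<open>?S\<close>, whereas
        \<open>V m p j\<close> may reach outside it; only sets meeting \<open>?S\<close> are
        kept.\<close>
      define c where "c j = (SOME y. y \<in> V m p j \<inter> ?S)" for j
      define J where "J = {j. j < N m p \<and> V m p j \<inter> ?S \<noteq> {}}"
      have c: "c j \<in> V m p j \<inter> ?S" if "j \<in> J" for j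
        using that unfolding J_def c_def by (metis (mono_tags, lifting) ex_in_conv mem_Collect_eq someI_ex)
      show "\<exists>K. finite K \<and> K \<subseteq> ?S \<and> ?S \<subseteq> (\<Union>x\<in>K. Y.mball x e)"
      proof (intro exI conjI)
        show "finite (c ` J)" unfolding J_def by simp
        show "c ` J \<subseteq> ?S" using c by blast
        show "?S \<subseteq> (\<Union>x\<in>c ` J. Y.mball x e)"
        proof
          fix y assume y: "y \<in> ?S"
          then obtain j where j: "j < N m p" "y \<in> V m p j" using NV(1) by blast
          then have jJ: "j \<in> J" using y unfolding J_def by blast
          have "mdist Y (c j) y \<le> (1/2)^(p + j)" using NV(3)[OF j(1)] c[OF jJ] j(2) by blast
          also have "\<dots> \<le> (1/2)^p" by (intro power_decreasing) auto
          finally have "y \<in> Y.mball (c j) e" using p c[OF jJ] NV(2)[OF j(1)] j(2) by auto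
          then show "y \<in> (\<Union>x\<in>c ` J. Y.mball x e)" using jJ by blast
        qed
      qed
    qed
    then show ?thesis
      unfolding L_def using Y.mtotally_bounded_eq_compact_closure_of comp
      unfolding mcomplete_of_def by blast
  qed
  define K where "K = (\<Union>m. L m)"
  have "hausdorff_measure Y s K = 0" if s: "s > 0" for s
  proof (rule hausdorff_measure_eq_0I)
    fix \<delta> \<eta> :: real assume \<delta>: "\<delta> > 0" and \<eta>: "\<eta> > 0"
    define c where "c = (1/2::real) powr s"
    have c: "0 < c" "c < 1" unfolding c_def using s powr_less_mono2[of s "1/2" 1] by auto
    have cp: "((1/2)^i) powr s = c^i" for i :: nat
      unfolding c_def by (simp add: powr_power powr_realpow[symmetric] powr_powr mult.commute)
    \<comment> \<open>For each piece \<open>m\<close>, \<open>p\<close> is so large that the cover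
      has mesh at most \<open>\<delta>\<close> and its geometric sum with ratio \<open>c\<close>
      stays within the share \<open>\<eta> * (1/2)^Suc m\<close>.\<close>
    have "\<exists>p. (1/2)^p \<le> \<delta> \<and> c^p / (1 - c) \<le> \<eta> * (1/2)^Suc m" for m
    proof -
      have pos: "\<eta> * (1/2)^Suc m * (1 - c) > 0" using \<eta> c by simp
      obtain p where p: "(1/2)^p < \<delta>" using real_arch_pow_inv[OF \<delta>, of "1/2"] by auto
      obtain q where q: "c^q < \<eta> * (1/2)^Suc m * (1 - c)" using real_arch_pow_inv[OF pos c(2)] by auto
      have "(1/2::real)^max p q \<le> (1/2)^p" "c^max p q \<le> c^q"
        using c by (intro power_decreasing; simp)+
      then have "(1/2)^max p q \<le> \<delta>" "c^max p q \<le> \<eta> * (1/2)^Suc m * (1 - c)" using p q by linarith+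
      then show ?thesis using c by (intro exI[of _ "max p q"]) (auto simp: divide_le_eq)
    qed
    then obtain p where p: "\<And>m. (1/2)^p m \<le> \<delta>" "\<And>m. c^p m / (1 - c) \<le> \<eta> * (1/2)^Suc m"
      by metis
    define C where "C = (\<lambda>(m, j). W m (p m) j) \<circ> prod_decode"
    let ?g = "\<lambda>(m, j). ennreal (enn2real (mdiam Y (W m (p m) j)) powr s)"
    show "\<exists>C. K \<subseteq> (\<Union>k. C k) \<and> (\<forall>k. C k \<subseteq> mspace Y \<and> mdiam Y (C k) \<le> ennreal \<delta>) \<and>
        (\<Sum>k. ennreal (enn2real (mdiam Y (C k)) powr s)) \<le> ennreal \<eta>"
    proof (intro exI[of _ C] conjI allI)
      show "K \<subseteq> (\<Union>k. C k)"
      proof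
        fix y assume "y \<in> K"
        then obtain m j where "y \<in> W m (p m) j" using LW unfolding K_def by blast
        then have "y \<in> C (prod_encode (m, j))" unfolding C_def by simp
        then show "y \<in> (\<Union>k. C k)" by blast
      qed
      fix k
      obtain m j where mj: "prod_decode k = (m, j)" by fastforce
      show "C k \<subseteq> mspace Y" unfolding C_def using mj W(1) by simp
      have "(1/2)^(p m + j) \<le> (1/2::real)^p m" by (intro power_decreasing) auto
      also have "\<dots> \<le> \<delta>" by (rule p)
      finally show "mdiam Y (C k) \<le> ennreal \<delta>"
        unfolding C_def using mj W(2)[of m "p m" j] by (auto intro: order_trans ennreal_leI)
    next
      have inner: "(\<Sum>j. ?g (m, j)) \<le> ennreal (\<eta> * (1/2)^Suc m)" for m
      proof -
        have "?g (m, j) \<le> ennreal (c^p m * c^j)" for j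
        proof -
          have "enn2real (mdiam Y (W m (p m) j)) \<le> (1/2)^(p m + j)"
            using W(2)[of m "p m" j] by (intro enn2real_leI) auto
          then have "enn2real (mdiam Y (W m (p m) j)) powr s \<le> ((1/2)^(p m + j)) powr s"
            using s by (intro powr_mono2) auto
          then show ?thesis unfolding cp by (simp add: ennreal_leI power_add)
        qed
        then have "(\<Sum>j. ?g (m, j)) \<le> (\<Sum>j. ennreal (c^p m * c^j))" by (intro suminf_le) auto
        also have "\<dots> = ennreal (c^p m * (1 / (1 - c)))"
          using c by (intro suminf_ennreal_eq sums_mult geometric_sums) auto
        also have "\<dots> \<le> ennreal (\<eta> * (1/2)^Suc m)" using p(2)[of m] by (intro ennreal_leI) simp
        finally show ?thesis .
      qed
      have "(\<Sum>k. ennreal (enn2real (mdiam Y (C k)) powr s)) = (\<Sum>k. ?g (prod_decode k))"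
        unfolding C_def by (simp add: case_prod_unfold)
      also have "\<dots> = (\<Sum>m. \<Sum>j. ?g (m, j))"
        by (rule suminf_ennreal_2dimen) simp
      also have "\<dots> \<le> (\<Sum>m. ennreal (\<eta> * (1/2)^Suc m))" using inner by (intro suminf_le) auto
      also have "\<dots> = ennreal (\<eta> * 1)"
        using \<eta> by (intro suminf_ennreal_eq sums_mult power_half_series) auto
      finally show "(\<Sum>k. ennreal (enn2real (mdiam Y (C k)) powr s)) \<le> ennreal \<eta>" by simp
    qed
  qed
  then have "hausdorff_dim Y K = 0" by (rule hausdorff_dim_eq_0I)
  moreover have "sigma_compact_in (mtopology_of Y) K"
    unfolding sigma_compact_in_def K_def mt[symmetric] using compact
    by (intro exI[of _ "range L"]) auto
  moreover have "K \<subseteq> mspace Y"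
    unfolding K_def L_def using closure_of_subset_topspace[of Y.mtopology] by auto
  moreover have "f ` mspace (submetric euclidean_metric X) \<subseteq> K"
  proof
    fix y assume "y \<in> f ` mspace (submetric euclidean_metric X)"
    then obtain x m where "y = f x" "x \<in> A m" "x \<in> X" using A(1) by auto
    then have "y \<in> L m"
      unfolding L_def using closure_of_subset[of "f ` (A m \<inter> X)" Y.mtopology] fY by auto
    then show "y \<in> K" unfolding K_def by blast
  qed
  ultimately show "\<exists>K\<subseteq>mspace Y. sigma_compact_in (mtopology_of Y) K \<and>
      f ` mspace (submetric euclidean_metric X) \<subseteq> K \<and> hausdorff_dim Y K = 0" by blast
qed

section \<open>Dyadic lattices and meager-additive sets\<close>

text \<open>The lattice of points with coordinates in \<open>2^-a Z\<close>, stated for an arbitrary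
  Euclidean space.\<close>

definition dyadic_lattice :: "nat \<Rightarrow> 'a::euclidean_space set" where
  "dyadic_lattice a = {x. \<forall>b\<in>Basis. (x \<bullet> b) * 2^a \<in> \<int>}"

lemma zero_in_dyadic_lattice: "0 \<in> dyadic_lattice a"
  by (simp add: dyadic_lattice_def)

lemma dyadic_lattice_diff:
  "x \<in> dyadic_lattice a \<Longrightarrow> y \<in> dyadic_lattice a \<Longrightarrow> x - y \<in> dyadic_lattice a"
  by (simp add: dyadic_lattice_def inner_diff_left left_diff_distrib)

lemma dyadic_lattice_mono:
  assumes "a \<le> a'"
  shows "dyadic_lattice a \<subseteq> dyadic_lattice a'"
proof
  fix x :: 'a assume x: "x \<in> dyadic_lattice a"
  have eq: "(x \<bullet> b) * 2^a' = ((x \<bullet> b) * 2^a) * 2^(a' - a)" for b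
    using assms by (simp add: power_add[symmetric])
  show "x \<in> dyadic_lattice a'"
    unfolding dyadic_lattice_def mem_Collect_eq
  proof
    fix b :: 'a assume "b \<in> Basis"
    then have "(x \<bullet> b) * 2^a \<in> \<int>" using x unfolding dyadic_lattice_def by blast
    then show "(x \<bullet> b) * 2^a' \<in> \<int>" unfolding eq[of b] by (rule Ints_mult) simp
  qed
qed

lemma dyadic_lattice_dense:
  fixes y :: "'a::euclidean_space"
  obtains p where "p \<in> dyadic_lattice a" "dist y p \<le> DIM('a) * (1/2)^a"
proof
  \<comment> \<open>Every coordinate is rounded down to the lattice; bounding the norm by the sum of
    the coordinate errors produces the factor \<open>DIM('a)\<close>.\<close>
  define p where "p = (\<Sum>b\<in>Basis. (real_of_int \<lfloor>(y \<bullet> b) * 2^a\<rfloor> / 2^a) *\<^sub>R b)"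
  have pb: "p \<bullet> b = real_of_int \<lfloor>(y \<bullet> b) * 2^a\<rfloor> / 2^a" if "b \<in> Basis" for b
    unfolding p_def using that by (rule inner_sum_left_Basis)
  show "p \<in> dyadic_lattice a" unfolding dyadic_lattice_def by (simp add: pb)
  have "\<bar>(y - p) \<bullet> b\<bar> \<le> (1/2)^a" if "b \<in> Basis" for b
  proof -
    have "(y - p) \<bullet> b = ((y \<bullet> b) * 2^a - real_of_int \<lfloor>(y \<bullet> b) * 2^a\<rfloor>) / 2^a"
      using that by (simp add: inner_diff_left pb diff_divide_distrib)
    also have "\<bar>\<dots>\<bar> \<le> 1 / 2^a"
      unfolding abs_divide by (intro frac_le) (auto, linarith)
    finally show ?thesis by (simp add: power_one_over)
  qed
  then have "(\<Sum>b\<in>Basis. \<bar>(y - p) \<bullet> b\<bar>) \<le> DIM('a) * (1/2)^a"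
    using sum_bounded_above by metis
  then show "dist y p \<le> DIM('a) * (1/2)^a"
    unfolding dist_norm using norm_le_l1 order_trans by blast
qed

text \<open>In direction \<open>b\<close> the difference is \<open>(1/2)^Suc a\<close> times the odd
  integer \<open>1 - 2 * z\<close>.\<close>

lemma dyadic_lattice_dist_midpoint:
  fixes g :: "'a::euclidean_space"
  assumes "g \<in> dyadic_lattice a" "b \<in> Basis"
  shows "dist ((1/2)^Suc a *\<^sub>R b) g \<ge> (1/2)^Suc a"
proof -
  obtain z :: int where z: "(g \<bullet> b) * 2^a = of_int z"
    using assms unfolding dyadic_lattice_def by (auto elim: Ints_cases)
  have "\<bar>1 - 2 * z\<bar> \<ge> 1" by presburger
  then have "\<bar>1 - 2 * real_of_int z\<bar> \<ge> 1" by linarith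
  then have "(1/2)^Suc a * 1 \<le> (1/2)^Suc a * \<bar>1 - 2 * real_of_int z\<bar>"
    by (intro mult_left_mono) auto
  also have "\<dots> = \<bar>(1/2)^Suc a * (1 - 2 * ((g \<bullet> b) * 2^a))\<bar>" unfolding z by (simp add: abs_mult)
  also have "(1/2)^Suc a * (1 - 2 * ((g \<bullet> b) * 2^a)) = ((1/2)^Suc a *\<^sub>R b - g) \<bullet> b"
    using assms(2) by (simp add: inner_diff_left algebra_simps power_one_over)
  also have "\<bar>\<dots>\<bar> \<le> norm ((1/2)^Suc a *\<^sub>R b - g)" using assms(2) by (rule Basis_le_norm)
  finally show ?thesis by (simp add: dist_norm)
qed

lemma finite_dyadic_lattice_bounded:
  "finite {g :: 'a::euclidean_space. g \<in> dyadic_lattice a \<and> norm g \<le> R}"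
proof -
  define F where "F = (\<lambda>z. real_of_int z / 2^a) ` {z. \<bar>real_of_int z\<bar> \<le> R * 2^a}"
  have "{z. \<bar>real_of_int z\<bar> \<le> R * 2^a} \<subseteq> {- \<lceil>R * 2^a\<rceil>..\<lceil>R * 2^a\<rceil>}"
    by (auto simp: abs_le_iff; linarith)
  then have fin: "finite F" unfolding F_def using finite_subset by blast
  have "g \<in> (\<lambda>f. \<Sum>b\<in>Basis. f b *\<^sub>R b) ` (PiE Basis (\<lambda>_. F))"
    if g: "g \<in> dyadic_lattice a" "norm g \<le> R" for g :: 'a
  proof
    show "g = (\<Sum>b\<in>Basis. restrict (\<lambda>b. g \<bullet> b) Basis b *\<^sub>R b)"
      by (simp add: euclidean_representation)
    have "g \<bullet> b \<in> F" if b: "b \<in> Basis" for b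
    proof -
      obtain z :: int where z: "(g \<bullet> b) * 2^a = of_int z"
        using g b unfolding dyadic_lattice_def by (auto elim: Ints_cases)
      have "\<bar>g \<bullet> b\<bar> * 2^a \<le> R * 2^a"
        using Basis_le_norm[OF b, of g] g(2) by (intro mult_right_mono) auto
      then have "\<bar>real_of_int z\<bar> \<le> R * 2^a" unfolding z[symmetric] by (simp add: abs_mult)
      moreover have "g \<bullet> b = real_of_int z / 2^a" using z by (simp add: field_simps)
      ultimately show ?thesis unfolding F_def by blast
    qed
    then show "restrict (\<lambda>b. g \<bullet> b) Basis \<in> PiE Basis (\<lambda>_. F)" by auto
  qed
  moreover have "finite ((\<lambda>f. \<Sum>b\<in>Basis. f b *\<^sub>R b) ` (PiE (Basis :: 'a set) (\<lambda>_. F)))"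
    using fin by (intro finite_imageI finite_PiE) auto
  ultimately show ?thesis by (metis (no_types, lifting) finite_subset mem_Collect_eq subsetI)
qed

text \<open>\<open>V\<close> is intersected successively with the finitely many translates of
  \<open>D\<close> by \<open>- p\<close>; each is open and dense, so a nonempty open set
  remains.\<close>

lemma open_dense_common_translate:
  fixes D :: "'a::euclidean_space set"
  assumes "finite P" "open D" "closure D = UNIV" "open V" "V \<noteq> {}"
  obtains \<tau> \<delta> where "\<delta> > 0" "cball \<tau> \<delta> \<subseteq> V" "\<And>p w. p \<in> P \<Longrightarrow> w \<in> cball \<tau> \<delta> \<Longrightarrow> p + w \<in> D"
proof -
  have "\<exists>V'. open V' \<and> V' \<noteq> {} \<and> V' \<subseteq> V \<and> (\<forall>p\<in>P. \<forall>w\<in>V'. p + w \<in> D)"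
    using assms(1)
  proof (induction P)
    case empty
    then show ?case using assms(4,5) by blast
  next
    case (insert p P)
    then obtain V' where V': "open V'" "V' \<noteq> {}" "V' \<subseteq> V" "\<forall>q\<in>P. \<forall>w\<in>V'. q + w \<in> D" by blast
    have "open ((+) p ` V')" using V'(1) by (rule open_translation)
    moreover have "(+) p ` V' \<noteq> {}" using V'(2) by simp
    ultimately have "D \<inter> (+) p ` V' \<noteq> {}"
      using assms(3) open_Int_closure_eq_empty[of "(+) p ` V'" D] by (simp add: Int_commute)
    then have ne: "V' \<inter> (+) (- p) ` D \<noteq> {}" by force
    have "open (V' \<inter> (+) (- p) ` D)" using V'(1) assms(2) by (intro open_Int open_translation)
    moreover have "\<forall>q\<in>insert p P. \<forall>w\<in>V' \<inter> (+) (- p) ` D. q + w \<in> D" using V'(4) by auto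
    ultimately show ?case using ne V'(3) by blast
  qed
  then obtain V' x where V': "open V'" "x \<in> V'" "V' \<subseteq> V" "\<forall>p\<in>P. \<forall>w\<in>V'. p + w \<in> D" by blast
  then obtain \<delta> where "\<delta> > 0" "cball x \<delta> \<subseteq> V'" using open_contains_cball by blast
  then show thesis using that[of \<delta> x] V' by blast
qed


text \<open>The hole is centred half a lattice step away from a point of
  \<open>x + dyadic_lattice a\<close> close to \<open>c\<close>. Rounding, half step and radius
  together cost at most \<open>DIM('a) + 1\<close> mesh widths.\<close>

lemma dyadic_lattice_hole:
  fixes c x :: "'a::euclidean_space"
  assumes "(real DIM('a) + 1) * (1/2)^a \<le> R" "R' \<le> (1/2)^a / 8"
  obtains y where "cball y R' \<subseteq> cball c R"
    "\<And>w g. w \<in> cball y R' \<Longrightarrow> g \<in> dyadic_lattice a \<Longrightarrow> dist (w - x) g \<ge> R'"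
proof -
  obtain b :: 'a where b: "b \<in> Basis" using nonempty_Basis by blast
  obtain p where p: "p \<in> dyadic_lattice a" "dist (c - x) p \<le> DIM('a) * (1/2)^a"
    using dyadic_lattice_dense by blast
  define u :: 'a where "u = (1/2)^Suc a *\<^sub>R b"
  have nu: "norm u = (1/2)^a / 2" unfolding u_def using b by simp
  define y where "y = x + p + u"
  show thesis
  proof
    show "cball y R' \<subseteq> cball c R"
    proof
      fix w assume "w \<in> cball y R'"
      then have "dist y w \<le> (1/2)^a / 8" using assms(2) by simp
      moreover have "dist c y \<le> DIM('a) * (1/2)^a + (1/2)^a / 2"
      proof -
        have "c - y = (c - x - p) - u" by (simp add: y_def)
        then have "norm (c - y) \<le> norm (c - x - p) + norm u" by (metis norm_triangle_ineq4)
        then show ?thesis using p(2) nu by (simp add: dist_norm)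
      qed
      moreover have "(0::real) < (1/2)^a" by simp
      ultimately have "dist c w \<le> DIM('a) * (1/2)^a + (1/2)^a"
        using dist_triangle[of c w y] by linarith
      then show "w \<in> cball c R" using assms(1) by (simp add: distrib_right)
    qed
    fix w g :: 'a assume w: "w \<in> cball y R'" and g: "g \<in> dyadic_lattice a"
    have "(1/2)^Suc a \<le> dist u (g - p)"
      unfolding u_def by (intro dyadic_lattice_dist_midpoint dyadic_lattice_diff g p(1) b)
    also have "u - (g - p) = (w - x - g) + (y - w)" by (simp add: y_def)
    then have "dist u (g - p) \<le> dist (w - x) g + dist y w"
      unfolding dist_norm by (metis norm_triangle_ineq)
    finally have "(1/2)^a / 2 \<le> dist (w - x) g + R'" using w by simp
    moreover have "(0::real) < (1/2)^a" by simp
    ultimately show "R' \<le> dist (w - x) g" using assms(2) by linarith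
  qed
qed

text \<open>The order of choice is \<open>a k\<close>, then \<open>R (Suc k)\<close>, then
  \<open>a (Suc k)\<close>. Thus \<open>R (Suc k)\<close> may depend on \<open>N k (a k)\<close>,
  which will involve the number of lattice points at level \<open>a k\<close>. The quantity
  \<open>4 * R (Suc k)\<close> bounds the diameter of a ball of radius
  \<open>2 * R (Suc k)\<close>.\<close>

lemma lattice_scales:
  fixes N :: "nat \<Rightarrow> nat \<Rightarrow> nat"
  assumes \<epsilon>: "\<And>i. \<epsilon> i > (0::real)"
  shows "\<exists>(a :: nat \<Rightarrow> nat) R. R 0 \<le> 1 \<and> (\<forall>k. R k > 0) \<and> mono a \<and> (\<forall>k. (real d + 1) * (1/2)^a k \<le> R k) \<and>
    (\<forall>k. R (Suc k) \<le> (1/2)^a k / 8) \<and> (\<forall>k. \<forall>q\<le>N k (a k). 4 * R (Suc k) \<le> \<epsilon> q)"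
proof -
  have ex_a: "\<exists>a'\<ge>a. (real d + 1) * (1/2)^a' \<le> R" if "R > 0" for R :: real and a
  proof -
    have "R / (real d + 1) > 0" using that by simp
    then obtain n where n: "(1/2)^n < R / (real d + 1)" using real_arch_pow_inv[of _ "1/2"] by auto
    have "(1/2::real)^max a n \<le> (1/2)^n" by (intro power_decreasing) auto
    then have "(1/2)^max a n \<le> R / (real d + 1)" using n by linarith
    then have "(real d + 1) * (1/2)^max a n \<le> R" by (simp add: le_divide_eq mult.commute)
    then show ?thesis using max.cobounded1 by blast
  qed
  \<comment> \<open>States are pairs of a lattice level and a radius: \<open>P\<close> constrains a
    state, \<open>Q\<close> the transition to the next one.\<close>
  define P where "P k x \<longleftrightarrow> snd x > 0 \<and> (real d + 1) * (1/2)^fst x \<le> snd x \<and> (k = 0 \<longrightarrow> snd x \<le> 1)"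
    for k :: nat and x :: "nat \<times> real"
  define Q where "Q k x y \<longleftrightarrow> fst x \<le> fst y \<and> snd y \<le> (1/2)^fst x / 8 \<and> (\<forall>q\<le>N k (fst x). 4 * snd y \<le> \<epsilon> q)"
    for k and x y :: "nat \<times> real"
  have "\<exists>f. \<forall>k. P k (f k) \<and> Q k (f k) (f (Suc k))"
  proof (rule dependent_nat_choice)
    obtain a where "(real d + 1) * (1/2)^a \<le> (1::real)" using ex_a[of 1] by auto
    then show "\<exists>x. P 0 x" unfolding P_def by (intro exI[of _ "(a, 1)"]) simp
  next
    fix x :: "nat \<times> real" and k
    define R' where "R' = Min (insert ((1/2)^fst x / 8) ((\<lambda>q. \<epsilon> q / 4) ` {..N k (fst x)}))"
    have R': "R' > 0" unfolding R'_def using \<epsilon> by auto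
    have R'1: "R' \<le> (1/2)^fst x / 8" unfolding R'_def by (intro Min_le) auto
    have R'2: "4 * R' \<le> \<epsilon> q" if "q \<le> N k (fst x)" for q
    proof -
      have "R' \<le> \<epsilon> q / 4" unfolding R'_def using that by (intro Min_le) auto
      then show ?thesis by simp
    qed
    obtain a' where "a' \<ge> fst x" "(real d + 1) * (1/2)^a' \<le> R'" using ex_a[OF R'] by blast
    then show "\<exists>y. P (Suc k) y \<and> Q k x y"
      unfolding P_def Q_def using R' R'1 R'2 by (intro exI[of _ "(a', R')"]) simp
  qed
  then obtain f where "\<And>k. P k (f k)" "\<And>k. Q k (f k) (f (Suc k))" by blast
  then have f: "\<And>k. snd (f k) > 0" "\<And>k. (real d + 1) * (1/2)^fst (f k) \<le> snd (f k)"
     "snd (f 0) \<le> 1" "\<And>k. fst (f k) \<le> fst (f (Suc k))" "\<And>k. snd (f (Suc k)) \<le> (1/2)^fst (f k) / 8"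
     "\<And>k q. q \<le> N k (fst (f k)) \<Longrightarrow> 4 * snd (f (Suc k)) \<le> \<epsilon> q"
    unfolding P_def Q_def by blast+
  show ?thesis
    using f by (intro exI[of _ "\<lambda>k. fst (f k)"] exI[of _ "\<lambda>k. snd (f k)"]) (auto simp: mono_iff_le_Suc)
qed

section \<open>Refining lattices and the meager set avoiding them\<close>

text \<open>Isolates what the category argument needs of the lattices. The radius \<open>r k\<close>
  is room for a shift about a lattice point within a ball of radius \<open>R k\<close>; for dyadic
  lattices it will be the mesh width.\<close>

locale lattice_sequence =
  fixes G :: "nat \<Rightarrow> 'a::euclidean_space set" and R r :: "nat \<Rightarrow> real"
  assumes G_mono: "mono G"
    and G_diff: "\<And>k x y. x \<in> G k \<Longrightarrow> y \<in> G k \<Longrightarrow> x - y \<in> G k"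
    and G_finite: "\<And>k b. finite {g \<in> G k. norm g \<le> b}"
    and R_pos: "\<And>k. R k > 0" and R_0: "R 0 \<le> 1" and R_half: "\<And>k. R (Suc k) \<le> R k / 2"
    and r_pos: "\<And>k. r k > 0" and r_le: "\<And>k. r k \<le> 1"
    and dense: "\<And>k c. \<exists>p\<in>G k. cball p (r k) \<subseteq> cball c (R k)"
    and hole: "\<And>k c x. \<exists>y. cball y (R (Suc k)) \<subseteq> cball c (R k) \<and>
        (\<forall>w\<in>cball y (R (Suc k)). \<forall>g\<in>G k. dist (w - x) g \<ge> R (Suc k))"
begin

definition avoid :: "'a set" where
  "avoid = {z. \<exists>m. \<forall>k\<ge>m. \<forall>g\<in>G k. dist z g \<ge> R (Suc k)}"

lemma R_le: "R k \<le> (1/2)^k"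
proof (induction k)
  case (Suc k) then show ?case using R_half[of k] by simp
qed (use R_0 in simp)

lemma R_antimono: "k \<le> l \<Longrightarrow> R l \<le> R k"
proof (rule lift_Suc_antimono_le)
  show "R (Suc n) \<le> R n" for n using R_half[of n] R_pos[of n] by linarith
qed

lemma ex_R_less:
  assumes "\<delta> > 0"
  obtains l where "l > k" "R l < \<delta>"
proof -
  obtain n where n: "(1/2)^n < \<delta>" using real_arch_pow_inv[OF assms, of "1/2"] by auto
  have "R (max n (Suc k)) \<le> R n" by (rule R_antimono) simp
  then show thesis using that[of "max n (Suc k)"] R_le[of n] n by auto
qed

text \<open>For fixed \<open>m\<close> the set is closed, and every ball contains a point of some
  \<open>G k\<close> with \<open>k > m\<close>, which is not in the set.\<close>

lemma meager_avoid: "meager avoid"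
proof -
  define A where "A m = {z. \<forall>k\<ge>m. \<forall>g\<in>G k. dist z g \<ge> R (Suc k)}" for m
  have "nowhere_dense (A m)" for m
    unfolding nowhere_dense_def
  proof (rule ccontr)
    have "A m = - (\<Union>k\<in>{m..}. \<Union>g\<in>G k. ball g (R (Suc k)))"
      unfolding A_def by (auto simp: dist_commute not_less; force)
    then have "closed (A m)" by (simp add: closed_def open_UN)
    moreover assume "interior (closure (A m)) \<noteq> {}"
    ultimately obtain c e where e: "e > 0" "cball c e \<subseteq> A m"
      by (metis all_not_in_conv closure_closed mem_interior_cball)
    obtain k where k: "k > m" "R k < e" using ex_R_less[OF e(1)] by blast
    obtain p where p: "p \<in> G k" "cball p (r k) \<subseteq> cball c (R k)" using dense by blast
    have "p \<in> cball p (r k)" using r_pos[of k] by simp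
    then have "p \<in> A m" using p(2) k(2) e(2) by fastforce
    then have "dist p p \<ge> R (Suc k)" using k(1) p(1) unfolding A_def mem_Collect_eq by (meson less_imp_le)
    then show False using R_pos[of "Suc k"] by simp
  qed
  moreover have "avoid = \<Union>(range A)" unfolding avoid_def A_def by blast
  ultimately show ?thesis unfolding meager_def by (intro exI[of _ "range A"]) auto
qed

text \<open>Serves the blocks in which the only task is to stay away from the lattices translated by
  \<open>x\<close>.\<close>

lemma hole_iterate:
  assumes "k \<le> l"
  shows "\<exists>y. cball y (R l) \<subseteq> cball c (R k) \<and>
    (\<forall>w\<in>cball y (R l). \<forall>i\<in>{k..<l}. \<forall>g\<in>G i. dist (w - x) g \<ge> R (Suc i))"
  using assms
proof (induction l rule: dec_induct)
  case base
  show ?case by (intro exI[of _ c]) simp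
next
  case (step l)
  then obtain y where y: "cball y (R l) \<subseteq> cball c (R k)"
    "\<forall>w\<in>cball y (R l). \<forall>i\<in>{k..<l}. \<forall>g\<in>G i. dist (w - x) g \<ge> R (Suc i)" by blast
  obtain z where z: "cball z (R (Suc l)) \<subseteq> cball y (R l)"
    "\<forall>w\<in>cball z (R (Suc l)). \<forall>g\<in>G l. dist (w - x) g \<ge> R (Suc l)" using hole by blast
  show ?case
  proof (intro exI[of _ z] conjI ballI)
    show "cball z (R (Suc l)) \<subseteq> cball c (R k)" using y(1) z(1) by blast
    fix w i g assume w: "w \<in> cball z (R (Suc l))" and i: "i \<in> {k..<Suc l}" and g: "g \<in> G i"
    show "dist (w - x) g \<ge> R (Suc i)"
    proof (cases "i = l")
      case True then show ?thesis using z(2) w g by blast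
    next
      case False
      then have "i \<in> {k..<l}" using i by auto
      moreover have "w \<in> cball y (R l)" using w z(1) by blast
      ultimately show ?thesis using y(2) g by blast
    qed
  qed
qed

text \<open>If some \<open>x\<close> missed infinitely many blocks, then in these blocks one could enter \<open>D n\<close> while
  keeping away from \<open>x + G k\<close>; the nested balls so obtained shrink to a point of
  \<open>(x + avoid) \<inter> (\<Inter>n. D n)\<close>.\<close>

lemma blocks_of_meager_translates:
  assumes "meager {x + m |x m. x \<in> X \<and> m \<in> avoid}"
  obtains \<tau> :: "nat \<Rightarrow> 'a" and h :: "nat \<Rightarrow> nat" where
    "strict_mono h" "\<forall>n. norm (\<tau> n) \<le> 1"
    "\<forall>x\<in>X. \<exists>m. \<forall>n\<ge>m. \<exists>k\<in>{h n..<h (Suc n)}. \<exists>g\<in>G k. dist x (\<tau> n + g) \<le> 2 * R (Suc k)"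
proof -
  obtain F :: "nat \<Rightarrow> 'a set" where F: "\<And>i. closed (F i)" "\<And>i. nowhere_dense (F i)" "incseq F"
      "{x + m |x m. x \<in> X \<and> m \<in> avoid} \<subseteq> (\<Union>i. F i)"
    using meager_cover_closed_incseq[OF assms] by blast
  define D where "D n = - F n" for n
  have D: "open (D n)" "closure (D n) = UNIV" for n
    using F(1,2)[of n] unfolding D_def nowhere_dense_def
    by (auto simp: closure_complement closure_closed)
  \<comment> \<open>\<open>t\<close> is a shift that carries all lattice points of norm at most 1
    into \<open>D n\<close> at once, with a margin \<open>R l\<close>, and stays within
    \<open>r k\<close>. The scale \<open>l\<close> starts the next block.\<close>
  define Q where "Q n k t l \<longleftrightarrow> l > k \<and> cball t (R l) \<subseteq> cball 0 (r k) \<and>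
      (\<forall>p\<in>{g \<in> G k. norm g \<le> 1}. \<forall>w\<in>cball t (R l). p + w \<in> D n)" for n k t l
  have "\<exists>t l. Q n k t l" for n k
  proof -
    obtain t \<delta> where t: "\<delta> > 0" "cball t \<delta> \<subseteq> ball 0 (r k)"
      "\<And>p w. p \<in> {g \<in> G k. norm g \<le> 1} \<Longrightarrow> w \<in> cball t \<delta> \<Longrightarrow> p + w \<in> D n"
      using open_dense_common_translate[OF G_finite[of k 1] D[of n], of "ball 0 (r k)"] r_pos[of k]
      by (metis (no_types, lifting) ball_eq_empty not_le open_ball)
    obtain l where l: "l > k" "R l < \<delta>" using ex_R_less[OF t(1)] by blast
    have "cball t (R l) \<subseteq> cball t \<delta>" using l(2) by auto
    then have "Q n k t l" unfolding Q_def using t(2,3) l(1) ball_subset_cball[of 0 "r k"] by blast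
    then show ?thesis by blast
  qed
  then obtain T H where "\<And>n k. Q n k (T n k) (H n k)" by metis
  then have TH: "\<And>n k. H n k > k" "\<And>n k. cball (T n k) (R (H n k)) \<subseteq> cball 0 (r k)"
      "\<And>n k p w. p \<in> G k \<Longrightarrow> norm p \<le> 1 \<Longrightarrow> w \<in> cball (T n k) (R (H n k)) \<Longrightarrow> p + w \<in> D n"
    unfolding Q_def by blast+
  \<comment> \<open>Starting at 0 makes the blocks \<open>{h n..<h (Suc n)}\<close> exhaust all
    scales.\<close>
  define h where "h = rec_nat 0 H"
  have hSuc: "h (Suc n) = H n (h n)" for n by (simp add: h_def)
  have hlt: "h n < h (Suc n)" for n unfolding hSuc by (rule TH(1))
  then have hmono: "strict_mono h" by (simp add: strict_mono_Suc_iff)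
  define \<tau> where "\<tau> n = T n (h n)" for n
  have \<tau>sub: "cball (\<tau> n) (R (h (Suc n))) \<subseteq> cball 0 (r (h n))" for n
    unfolding \<tau>_def hSuc by (rule TH(2))
  have \<tau>D: "p + w \<in> D n" if "p \<in> G (h n)" "norm p \<le> 1" "w \<in> cball (\<tau> n) (R (h (Suc n)))" for n p w
    using TH(3) that unfolding \<tau>_def hSuc by blast
  have \<tau>1: "norm (\<tau> n) \<le> 1" for n
  proof -
    have "\<tau> n \<in> cball 0 (r (h n))" using \<tau>sub[of n] R_pos[of "h (Suc n)"] by (meson centre_in_cball less_imp_le subsetD)
    then show ?thesis using r_le[of "h n"] by simp
  qed
  have "\<exists>m. \<forall>n\<ge>m. \<exists>k\<in>{h n..<h (Suc n)}. \<exists>g\<in>G k. dist x (\<tau> n + g) \<le> 2 * R (Suc k)"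
    if xX: "x \<in> X" for x
  proof (rule ccontr)
    define bad where "bad n \<longleftrightarrow> (\<forall>k\<in>{h n..<h (Suc n)}. \<forall>g\<in>G k. dist x (\<tau> n + g) > 2 * R (Suc k))" for n
    assume "\<not> ?thesis"
    then have inf: "\<exists>n\<ge>m. bad n" for m unfolding bad_def by (meson not_le)
    have step: "\<exists>y. cball y (R (h (Suc n))) \<subseteq> cball c (R (h n)) \<and>
        (\<forall>w\<in>cball y (R (h (Suc n))). \<forall>i\<in>{h n..<h (Suc n)}. \<forall>g\<in>G i. dist (w - x) g \<ge> R (Suc i)) \<and>
        (bad n \<longrightarrow> cball y (R (h (Suc n))) \<subseteq> D n)"
      if c: "cball c (R (h n)) \<subseteq> cball 0 1" for n c
    proof (cases "bad n")
      case False
      then show ?thesis using hole_iterate[OF less_imp_le[OF hlt[of n]], of c x] by simp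
    next
      case True
      obtain p where p: "p \<in> G (h n)" "cball p (r (h n)) \<subseteq> cball c (R (h n))" using dense by blast
      have "p \<in> cball p (r (h n))" using r_pos[of "h n"] by simp
      then have p1: "norm p \<le> 1" using p(2) c by fastforce
      have shift: "w - p \<in> cball (\<tau> n) (R (h (Suc n)))" if "w \<in> cball (p + \<tau> n) (R (h (Suc n)))" for w
        using that by (simp add: dist_norm algebra_simps)
      show ?thesis
      proof (intro exI[of _ "p + \<tau> n"] conjI ballI impI)
        show "cball (p + \<tau> n) (R (h (Suc n))) \<subseteq> cball c (R (h n))"
        proof
          fix w assume "w \<in> cball (p + \<tau> n) (R (h (Suc n)))"
          then have "w - p \<in> cball 0 (r (h n))" using shift \<tau>sub by blast
          then have "w \<in> cball p (r (h n))" by (simp add: dist_norm norm_minus_commute)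
          then show "w \<in> cball c (R (h n))" using p(2) by blast
        qed
        show "cball (p + \<tau> n) (R (h (Suc n))) \<subseteq> D n"
        proof
          fix w assume "w \<in> cball (p + \<tau> n) (R (h (Suc n)))"
          then have "p + (w - p) \<in> D n" using \<tau>D p(1) p1 shift by blast
          then show "w \<in> D n" by simp
        qed
        fix w i g assume w: "w \<in> cball (p + \<tau> n) (R (h (Suc n)))" and i: "i \<in> {h n..<h (Suc n)}"
          and g: "g \<in> G i"
        have le: "R (h (Suc n)) \<le> R (Suc i)" using i by (intro R_antimono) auto
        have "p \<in> G i" using p(1) monoD[OF G_mono, of "h n" i] i by auto
        then have "p - g \<in> G i" using g G_diff by blast
        \<comment> \<open>Badness is applied to the lattice point \<open>p - g\<close>: it says that
          the new centre \<open>p + \<tau> n\<close> is farther than \<open>2 * R (Suc i)\<close>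
          from \<open>x + g\<close>. Passing from the centre to \<open>w\<close> loses at most
          \<open>R (Suc i)\<close>.\<close>
        then have "2 * R (Suc i) < dist x (\<tau> n + (p - g))" using True i unfolding bad_def by blast
        also have "\<dots> = norm ((p + \<tau> n - w) + (w - x - g))"
          by (simp add: dist_norm norm_minus_commute algebra_simps)
        also have "\<dots> \<le> R (h (Suc n)) + dist (w - x) g"
          using w norm_triangle_ineq[of "p + \<tau> n - w" "w - x - g"] by (simp add: dist_norm)
        finally show "R (Suc i) \<le> dist (w - x) g" using le by linarith
      qed
    qed
    have "\<exists>c. \<forall>n. cball (c n) (R (h n)) \<subseteq> cball 0 1 \<and>
      (cball (c (Suc n)) (R (h (Suc n))) \<subseteq> cball (c n) (R (h n)) \<and>
        (\<forall>w\<in>cball (c (Suc n)) (R (h (Suc n))). \<forall>i\<in>{h n..<h (Suc n)}. \<forall>g\<in>G i. dist (w - x) g \<ge> R (Suc i)) \<and>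
        (bad n \<longrightarrow> cball (c (Suc n)) (R (h (Suc n))) \<subseteq> D n))"
    proof (rule dependent_nat_choice)
      show "\<exists>c. cball c (R (h 0)) \<subseteq> cball (0::'a) 1"
        using R_0 by (intro exI[of _ 0]) (auto simp: h_def)
    next
      fix c n assume c: "cball c (R (h n)) \<subseteq> cball (0::'a) 1"
      show "\<exists>y. cball y (R (h (Suc n))) \<subseteq> cball 0 1 \<and>
        cball y (R (h (Suc n))) \<subseteq> cball c (R (h n)) \<and>
        (\<forall>w\<in>cball y (R (h (Suc n))). \<forall>i\<in>{h n..<h (Suc n)}. \<forall>g\<in>G i. dist (w - x) g \<ge> R (Suc i)) \<and>
        (bad n \<longrightarrow> cball y (R (h (Suc n))) \<subseteq> D n)"
        using step[OF c] c by (meson subset_trans)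
    qed
    then obtain c where c: "\<And>n. cball (c (Suc n)) (R (h (Suc n))) \<subseteq> cball (c n) (R (h n))"
       "\<And>n w i g. w\<in>cball (c (Suc n)) (R (h (Suc n))) \<Longrightarrow> i\<in>{h n..<h (Suc n)} \<Longrightarrow> g\<in>G i
          \<Longrightarrow> dist (w - x) g \<ge> R (Suc i)"
       "\<And>n. bad n \<Longrightarrow> cball (c (Suc n)) (R (h (Suc n))) \<subseteq> D n"
      by metis
    have "(\<Inter>n. cball (c n) (R (h n))) \<noteq> {}"
    proof (rule compact_nest)
      show "compact (cball (c n) (R (h n)))" for n by simp
      show "cball (c n) (R (h n)) \<noteq> {}" for n using R_pos[of "h n"] by simp
      show "cball (c n) (R (h n)) \<subseteq> cball (c m) (R (h m))" if "m \<le> n" for m n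
        using lift_Suc_antimono_le[of "\<lambda>n. cball (c n) (R (h n))"] c(1) that by blast
    qed
    then obtain w where w: "\<And>n. w \<in> cball (c n) (R (h n))" by blast
    have "dist (w - x) g \<ge> R (Suc i)" if g: "g \<in> G i" for i g
    proof -
      have "\<exists>n. i \<in> {h n..<h (Suc n)}"
      proof (induction i)
        case 0 then show ?case using hlt[of 0] by (intro exI[of _ 0]) (simp add: h_def)
      next
        case (Suc i)
        then obtain n where "h n \<le> i" "i < h (Suc n)" by auto
        then show ?case
          using hlt[of "Suc n"] by (cases "Suc i < h (Suc n)") (force, intro exI[of _ "Suc n"], simp)
      qed
      then show ?thesis using c(2) w g by blast
    qed
    then have "w - x \<in> avoid" unfolding avoid_def by blast
    then have "w \<in> {x + m |x m. x \<in> X \<and> m \<in> avoid}" using xX by force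
    then obtain i where i: "w \<in> F i" using F(4) by blast
    \<comment> \<open>As \<open>F\<close> is increasing, a single bad block beyond \<open>i\<close>
      contradicts \<open>w \<in> F i\<close>.\<close>
    obtain n where n: "n \<ge> i" "bad n" using inf by blast
    then have "w \<in> D n" using c(3) w by blast
    moreover have "w \<in> F n" using i n(1) F(3) unfolding incseq_def by blast
    ultimately show False unfolding D_def by simp
  qed
  then show thesis using that hmono \<tau>1 by blast
qed

end


section \<open>From meager-additivity to fine covers\<close>

text \<open>One late block of scales covers a piece by balls about shifted lattice points. At scale
  \<open>k\<close> all balls get the same weight, with total \<open>(1/2)^k\<close>, so a late block
  has small total weight; the radii were chosen small enough for these weights.\<close>

lemma meager_additive_imp_sigma_finely_coverable:
  fixes X :: "'a::euclidean_space set"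
  assumes X: "meager_additive X"
  shows "sigma_finely_coverable X"
  unfolding sigma_finely_coverable_def
proof (intro allI impI)
  fix \<epsilon> :: "nat \<Rightarrow> real" assume "\<forall>i. \<epsilon> i > 0"
  then have \<epsilon>: "\<And>i. \<epsilon> i > 0" by blast
  \<comment> \<open>The bound \<open>k + 3\<close> accounts for a point of norm at most
    \<open>m \<le> k\<close>, a shift of norm at most 1 and a distance of at most 2.\<close>
  define P :: "nat \<Rightarrow> nat \<Rightarrow> 'a set" where
    "P k b = {g. g \<in> dyadic_lattice b \<and> norm g \<le> real k + 3}" for k b
  have finP: "finite (P k b)" for k b unfolding P_def by (rule finite_dyadic_lattice_bounded)
  have cardP: "card (P k b) > 0" for k b
    using finP[of k b] zero_in_dyadic_lattice[of b] unfolding P_def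
    by (subst card_gt_0_iff) auto
  obtain a :: "nat \<Rightarrow> nat" and R where R0: "R 0 \<le> 1" and a: "mono a" and
    scales: "\<forall>k. R k > 0" "\<forall>k. (real DIM('a) + 1) * (1/2)^a k \<le> R k" "\<forall>k. R (Suc k) \<le> (1/2)^a k / 8"
      "\<forall>k. \<forall>q\<le>card (P k (a k)) * 2^k. 4 * R (Suc k) \<le> \<epsilon> q"
    using lattice_scales[where \<epsilon> = \<epsilon> and d = "DIM('a)" and N = "\<lambda>k b. card (P k b) * 2^k", OF \<epsilon>]
    by (elim exE conjE)
  note Rpos = scales(1)[rule_format] and aR = scales(2)[rule_format] and
    Ra = scales(3)[rule_format] and R\<epsilon> = scales(4)[rule_format]
  interpret lattice_sequence "\<lambda>k. dyadic_lattice (a k) :: 'a set" R "\<lambda>k. (1/2)^a k"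
  proof
    show "mono (\<lambda>k. dyadic_lattice (a k) :: 'a set)"
      by (intro monoI dyadic_lattice_mono monoD[OF a])
    show "\<And>k x y. x \<in> dyadic_lattice (a k) \<Longrightarrow> y \<in> dyadic_lattice (a k) \<Longrightarrow> x - y \<in> dyadic_lattice (a k)"
      by (rule dyadic_lattice_diff)
    show "\<And>k b. finite {g \<in> dyadic_lattice (a k). norm g \<le> b}"
      by (rule finite_dyadic_lattice_bounded)
    fix k
    have le: "(1/2)^a k \<le> R k"
    proof -
      have "1 * (1/2)^a k \<le> (real DIM('a) + 1) * (1/2)^a k" by (intro mult_right_mono) auto
      then show ?thesis using aR[of k] by linarith
    qed
    show "R (Suc k) \<le> R k / 2" using Ra[of k] le Rpos[of k] by linarith
    fix c x :: 'a
    show "\<exists>p\<in>dyadic_lattice (a k). cball p ((1/2)^a k) \<subseteq> cball c (R k)"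
    proof -
      obtain p where p: "p \<in> dyadic_lattice (a k)" "dist c p \<le> DIM('a) * (1/2)^a k"
        using dyadic_lattice_dense by blast
      have "cball p ((1/2)^a k) \<subseteq> cball c (R k)"
      proof
        fix w assume "w \<in> cball p ((1/2)^a k)"
        then have "dist c w \<le> (real DIM('a) + 1) * (1/2)^a k"
          using dist_triangle[of c w p] p(2) by (simp add: distrib_right)
        then show "w \<in> cball c (R k)" using aR[of k] by simp
      qed
      then show ?thesis using p(1) by blast
    qed
    show "\<exists>y. cball y (R (Suc k)) \<subseteq> cball c (R k) \<and>
        (\<forall>w\<in>cball y (R (Suc k)). \<forall>g\<in>dyadic_lattice (a k). dist (w - x) g \<ge> R (Suc k))"
      using dyadic_lattice_hole[OF aR[of k] Ra[of k], of c x] by metis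
  qed (use R0 Rpos in \<open>auto simp: power_le_one\<close>)
  have "meager {x + m |x m. x \<in> X \<and> m \<in> avoid}"
    using X meager_avoid unfolding meager_additive_def by blast
  then obtain \<tau> :: "nat \<Rightarrow> 'a" and h :: "nat \<Rightarrow> nat" where h: "strict_mono h"
    and \<tau>: "\<forall>n. norm (\<tau> n) \<le> 1"
    and block: "\<forall>x\<in>X. \<exists>m. \<forall>n\<ge>m. \<exists>k\<in>{h n..<h (Suc n)}. \<exists>g\<in>dyadic_lattice (a k).
        dist x (\<tau> n + g) \<le> 2 * R (Suc k)"
    by (rule blocks_of_meager_translates)
  define A where "A m = {x. norm x \<le> real m \<and> (\<forall>n\<ge>m. \<exists>k\<in>{h n..<h (Suc n)}. \<exists>g\<in>dyadic_lattice (a k).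
        dist x (\<tau> n + g) \<le> 2 * R (Suc k))}" for m
  have "X \<subseteq> (\<Union>m. A m)"
  proof
    fix x assume "x \<in> X"
    then obtain m where m: "\<forall>n\<ge>m. \<exists>k\<in>{h n..<h (Suc n)}. \<exists>g\<in>dyadic_lattice (a k).
        dist x (\<tau> n + g) \<le> 2 * R (Suc k)" using block by blast
    obtain l where l: "norm x \<le> real l" using real_arch_simple by blast
    have "x \<in> A (max m l)" unfolding A_def using m l by auto
    then show "x \<in> (\<Union>m. A m)" by blast
  qed
  moreover have "finely_covered \<epsilon> (A m)" for m
  proof (rule finely_coveredI_weights[where 'i = "nat \<times> 'a"])
    fix p
    obtain l where l: "(1/2)^l < 1 / (2 * (real p + 1))"
      using real_arch_pow_inv[of "1 / (2 * (real p + 1))" "1/2"] by auto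
    \<comment> \<open>\<open>n \<ge> m\<close> makes block \<open>n\<close> cover
      \<open>A m\<close>; \<open>n \<ge> l\<close> together with \<open>n \<le> h n\<close> makes
      its total weight less than \<open>1 / (p + 1)\<close>.\<close>
    define n where "n = max m l"
    have hn: "n \<le> h n" using h by (rule strict_mono_imp_increasing)
    define I where "I = (SIGMA k:{h n..<h (Suc n)}. P k (a k))"
    define U where "U = (\<lambda>(k, g). cball (\<tau> n + g) (2 * R (Suc k)))"
    define w :: "nat \<times> 'a \<Rightarrow> real" where "w = (\<lambda>(k, g). 1 / (card (P k (a k)) * 2^k))"
    have "sum w I = (\<Sum>k\<in>{h n..<h (Suc n)}. \<Sum>g\<in>P k (a k). 1 / (card (P k (a k)) * 2^k))"
      unfolding I_def w_def using finP by (subst sum.Sigma) auto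
    also have "\<dots> = (\<Sum>k\<in>{h n..<h (Suc n)}. (1/2)^k)"
      using cardP by (intro sum.cong refl) (simp add: power_one_over)
    also have "\<dots> \<le> 2 * (1/2)^h n"
    proof -
      have "(\<Sum>k\<in>{i..<j}. (1/2::real)^k) \<le> 2 * (1/2)^i - 2 * (1/2)^j" if "i \<le> j" for i j :: nat
        using that by (induction j rule: dec_induct) auto
      then have "(\<Sum>k\<in>{h n..<h (Suc n)}. (1/2::real)^k) \<le> 2 * (1/2)^h n - 2 * (1/2)^h (Suc n)"
        using strict_monoD[OF h, of n "Suc n"] by simp
      moreover have "(0::real) \<le> (1/2)^h (Suc n)" by simp
      ultimately show ?thesis by linarith
    qed
    also have "\<dots> \<le> 2 * (1/2)^l"
      using hn unfolding n_def by (intro mult_left_mono power_decreasing) auto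
    also have "\<dots> < 1 / (real p + 1)" using l by (simp add: field_simps)
    finally have sw: "sum w I < 1 / (real p + 1)" .
    have cover: "A m \<subseteq> (\<Union>i\<in>I. U i)"
    proof
      fix x assume "x \<in> A m"
      then obtain k g where k: "k \<in> {h n..<h (Suc n)}" "g \<in> dyadic_lattice (a k)"
          "dist x (\<tau> n + g) \<le> 2 * R (Suc k)" "norm x \<le> real m"
        unfolding A_def using max.cobounded1[of m l] n_def by blast
      have "R (Suc k) \<le> R 0" by (rule R_antimono) simp
      then have "dist x (\<tau> n + g) \<le> 2" using k(3) R0 by linarith
      moreover have "g = (x - \<tau> n) - (x - (\<tau> n + g))" by simp
      then have "norm g \<le> norm x + norm (\<tau> n) + dist x (\<tau> n + g)"
        unfolding dist_norm by (metis add_right_mono norm_triangle_ineq4 order_trans)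
      moreover have "real m \<le> real k" using k(1) hn unfolding n_def by simp
      ultimately have "norm g \<le> real k + 3" using k(4) \<tau>[rule_format, of n] by linarith
      then have "(k, g) \<in> I" using k unfolding I_def P_def by auto
      moreover have "x \<in> U (k, g)" using k(3) unfolding U_def by (simp add: dist_commute)
      ultimately show "x \<in> (\<Union>i\<in>I. U i)" by blast
    qed
    have weight: "1 / (real q + 1) \<le> w (k, g)"
      if xy: "x \<in> U (k, g)" "y \<in> U (k, g)" and gt: "dist x y > \<epsilon> q" for k g q x y
    proof -
      have "dist x y \<le> 4 * R (Suc k)"
        using xy dist_triangle3[of x y "\<tau> n + g"] unfolding U_def by simp
      then have "\<not> q \<le> card (P k (a k)) * 2^k" using gt R\<epsilon>[of q k] by linarith
      then have "real (card (P k (a k)) * 2^k) \<le> real q + 1" by linarith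
      moreover have "real (card (P k (a k)) * 2^k) > 0" using cardP by simp
      ultimately show ?thesis unfolding w_def by (simp add: frac_le)
    qed
    show "\<exists>(I :: (nat \<times> 'a) set) U w.
      finite I \<and> A m \<subseteq> (\<Union>i\<in>I. U i) \<and> (\<forall>i\<in>I. w i \<ge> 0) \<and> sum w I < 1 / (real p + 1) \<and>
      (\<forall>i\<in>I. \<forall>q. \<forall>x\<in>U i. \<forall>y\<in>U i. dist x y > \<epsilon> q \<longrightarrow> w i \<ge> 1 / (real q + 1))"
    proof (rule exI[of _ I], rule exI[of _ U], rule exI[of _ w], intro conjI ballI allI impI)
      show "finite I" unfolding I_def using finP by auto
      show "w i \<ge> 0" for i unfolding w_def by (simp add: case_prod_unfold)
      fix i q x y assume "x \<in> U i" "y \<in> U i" "dist x y > \<epsilon> q"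
      then show "1 / (real q + 1) \<le> w i" using weight[of x "fst i" "snd i" y q] by simp
    qed (use cover sw in auto)
  qed
  ultimately show "\<exists>A :: nat \<Rightarrow> 'a set. X \<subseteq> (\<Union>m. A m) \<and> (\<forall>m. finely_covered \<epsilon> (A m))"
    by blast
qed

(* 'b is arbitrary, so every complete metric space (up to isometry) occurs as a target space;
   the summand real makes the universe of target spaces at least of size continuum. *)
theorem theorem6p4:
  fixes X :: "(real ^ 'n) set"
  shows "meager_additive X \<longleftrightarrow>
    sharp_measure_zero TYPE('b + real) (submetric euclidean_metric X)"
proof
  assume "meager_additive X"
  then show "sharp_measure_zero TYPE('b + real) (submetric euclidean_metric X)"
    by (intro sigma_finely_coverable_imp_sharp_measure_zero meager_additive_imp_sigma_finely_coverable)
next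
  assume sharp: "sharp_measure_zero TYPE('b + real) (submetric euclidean_metric X)"
  obtain j :: "real ^ 'n \<Rightarrow> real" where "inj j"
    by (rule ex_inj_real)
  \<comment> \<open>The summand \<open>real\<close> provides room for a copy of the space among the
    points of the target type.\<close>
  then have "inj (Inr \<circ> j :: real ^ 'n \<Rightarrow> 'b + real)"
    by (intro inj_compose) auto
  with sharp have "sigma_finely_coverable X"
    by (rule sharp_measure_zero_imp_sigma_finely_coverable)
  then show "meager_additive X"
    by (rule sigma_finely_coverable_imp_meager_additive)
qed

end
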